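(* Let $E$ be a finite ground set and $\mathcal{M}$ a laminar matroid on $E$ of depth $\ell\ge1$, with matroid basis polytope $P_{\mathcal{M}}$. Then $\mathrm{Lip}(P_{\mathcal{M}})\le\widetilde{\mathrm{Lip}}(P_{\mathcal{M}})\le\ell+1$.
   Context: A family $\mathcal{A}$ of subsets of $E$ is laminar if any two intersecting members are nested; assuming $E\in\mathcal{A}$, its depth is the largest $\ell$ such that there is a chain $A_1\subsetneq A_2\subsetneq\cdots\subsetneq A_\ell=E$ in $\mathcal{A}$. A laminar matroid is $\mathcal{M}=\{I\subseteq E:|I\cap A|\le u(A)\ \forall A\in\mathcal{A}\}$ for a laminar $\mathcal{A}$ and capacities $u:\mathcal{A}\to\mathbb{Z}_{\ge0}$; its depth is that of $\mathcal{A}$. $P_{\mathcal{M}}$ is the convex hull of indicator vectors of bases of $\mathcal{M}$, lying in $\mathrm{rank}(\mathcal{M})\cdot\Delta_{|E|}$, $\Delta_k=\{x\in\mathbb{R}^k_{\ge0}:\|x\|_1=1\}$. For convex $\mathcal{B}\subseteq\Delta_k$: $\sigma:[n]\times[k]\to\mathbb{R}_{\ge0}$ satisfies $\sigma\sim(\mathcal{B},h)$ if $\sum_p\sigma(p,\cdot)=h$ and $\sigma(p,\cdot)\in\|\sigma(p,\cdot)\|_1\mathcal{B}$ for all $p$; for $h,h'\in\mathcal{B}$ and $\sigma\sim(\mathcal{B},h)$ with $\|\sigma\|_1=1$, $\mathrm{OAT}(\mathcal{B},h,h',\sigma)=\min\|\sigma-\sigma'\|_1$ over $\sigma'\sim(\mathcal{B},h')$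 with $\|\sigma'(p,\cdot)\|_1=\|\sigma(p,\cdot)\|_1$ for all $p$; $\mathrm{Lip}(\mathcal{B})=\max\mathrm{OAT}/\|h-h'\|_1$, extended to scaled sets by $\mathrm{Lip}(c\mathcal{B})=\mathrm{Lip}(\mathcal{B})$. For a polytope $\mathcal{B}\subseteq c\Delta_k$ with vertex set $V$, $h,h'\in\mathcal{B}$, and a distribution $\mu$ on $V$ with $\sum_v\mu_vv=h$: $\widetilde{\mathrm{OAT}}(\mathcal{B},h,h',\mu)=\min\sum_{v,v'}\kappa(v,v')\|v-v'\|_1$ over distributions $\mu'$ on $V$ with $\sum_v\mu'_vv=h'$ and couplings $\kappa$ of $(\mu,\mu')$; $\widetilde{\mathrm{Lip}}(\mathcal{B})=\max\widetilde{\mathrm{OAT}}/\|h-h'\|_1$ over all $h,h',\mu$. *)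

theory Defs
  imports "HOL-Probability.Probability"
begin

(* Vectors indexed by a finite ground set E are elements of real ^ 'e with E :: 'e set; all
   vectors arising from E vanish outside E, so E may be a proper (even empty) subset of UNIV. *)

definition l1_norm :: "real ^ 'e \<Rightarrow> real" where
  "l1_norm x = (\<Sum>i\<in>UNIV. \<bar>x $ i\<bar>)"

definition unit_simplex :: "(real ^ 'e) set" where
  "unit_simplex = {x. (\<forall>i. 0 \<le> x $ i) \<and> l1_norm x = 1}"

definition laminar_family :: "'e set \<Rightarrow> 'e set set \<Rightarrow> bool" where
  "laminar_family E \<A> \<longleftrightarrow>
     \<A> \<subseteq> Pow E \<and> (\<forall>X\<in>\<A>. \<forall>Y\<in>\<A>. X \<inter> Y \<noteq> {} \<longrightarrow> X \<subseteq> Y \<or> Y \<subseteq> X)"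

definition family_depth :: "'e set \<Rightarrow> 'e set set \<Rightarrow> nat" where
  "family_depth E \<A> = Max {l. 1 \<le> l \<and>
     (\<exists>c :: nat \<Rightarrow> 'e set. (\<forall>i\<in>{1..l}. c i \<in> \<A>) \<and> (\<forall>i\<in>{1..<l}. c i \<subset> c (Suc i)) \<and> c l = E)}"

definition laminar_matroid :: "'e set \<Rightarrow> 'e set set \<Rightarrow> ('e set \<Rightarrow> nat) \<Rightarrow> 'e set set" where
  "laminar_matroid E \<A> u = {I. I \<subseteq> E \<and> (\<forall>A\<in>\<A>. card (I \<inter> A) \<le> u A)}"

definition bases :: "'e set set \<Rightarrow> 'e set set" where
  "bases M = {B \<in> M. \<forall>I\<in>M. B \<subseteq> I \<longrightarrow> I = B}"

definition indicator_vec :: "'e set \<Rightarrow> real ^ 'e" where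
  "indicator_vec S = (\<chi> i. indicator S i)"

definition basis_polytope :: "'e set set \<Rightarrow> (real ^ 'e) set" where
  "basis_polytope M = convex hull (indicator_vec ` bases M)"

(* sigma : [n] x [k] -> R is encoded by its rows \<sigma> p for p < n; values at p \<ge> n are ignored. *)
definition allocates :: "nat \<Rightarrow> (real ^ 'e) set \<Rightarrow> real ^ 'e \<Rightarrow> (nat \<Rightarrow> real ^ 'e) \<Rightarrow> bool" where
  "allocates n \<B> h \<sigma> \<longleftrightarrow>
     (\<forall>p<n. \<forall>i. 0 \<le> \<sigma> p $ i) \<and> (\<Sum>p<n. \<sigma> p) = h \<and>
     (\<forall>p<n. \<sigma> p \<in> (\<lambda>x. l1_norm (\<sigma> p) *\<^sub>R x) ` \<B>)"

definition OAT ::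
  "nat \<Rightarrow> (real ^ 'e) set \<Rightarrow> real ^ 'e \<Rightarrow> real ^ 'e \<Rightarrow> (nat \<Rightarrow> real ^ 'e) \<Rightarrow> real" where
  "OAT n \<B> h h' \<sigma> = Inf {(\<Sum>p<n. l1_norm (\<sigma> p - \<sigma>' p)) | \<sigma>'.
     allocates n \<B> h' \<sigma>' \<and> (\<forall>p<n. l1_norm (\<sigma>' p) = l1_norm (\<sigma> p))}"

(* The supremum also ranges over the number n of rows. It is taken in ennreal, where it is 0 if
   there is no pair h \<noteq> h', i.e. if \<B> is a single point. *)
definition Lip_simplex :: "(real ^ 'e) set \<Rightarrow> ennreal" where
  "Lip_simplex \<B> = Sup {ennreal (OAT n \<B> h h' \<sigma> / l1_norm (h - h')) | n h h' \<sigma>.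
     h \<in> \<B> \<and> h' \<in> \<B> \<and> h \<noteq> h' \<and> allocates n \<B> h \<sigma> \<and> (\<Sum>p<n. l1_norm (\<sigma> p)) = 1}"

(* Lip (c \<B>) = Lip \<B>, see Lip_scaled below. For nonempty \<C> there is at most one pair (c, \<B>),
   and there is none for \<C> = {0} (the polytope of a matroid of rank 0); then Lip \<C> = 0. *)
definition Lip :: "(real ^ 'e) set \<Rightarrow> ennreal" where
  "Lip \<C> = Sup {Lip_simplex \<B> | c \<B>. 0 < c \<and> \<B> \<subseteq> unit_simplex \<and> \<C> = (\<lambda>x. c *\<^sub>R x) ` \<B>}"

lemma Lip_scaled:
  fixes \<B> :: "(real ^ 'e) set"
  assumes "0 < c" "\<B> \<subseteq> unit_simplex" "\<B> \<noteq> {}"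
  shows "Lip ((\<lambda>x. c *\<^sub>R x) ` \<B>) = Lip_simplex \<B>"
proof -
  have uniq: "\<B>' = \<B>" if d: "0 < d" "\<B>' \<subseteq> unit_simplex"
    and eq: "(\<lambda>x. c *\<^sub>R x) ` \<B> = (\<lambda>x. d *\<^sub>R x) ` \<B>'" for d \<B>'
  proof -
    have l1: "l1_norm (a *\<^sub>R x) = a" if "0 < a" "x \<in> unit_simplex" for a and x :: "real ^ 'e"
    proof -
      have "l1_norm (a *\<^sub>R x) = \<bar>a\<bar> * l1_norm x"
        by (simp add: l1_norm_def abs_mult sum_distrib_left)
      then show ?thesis using that by (simp add: unit_simplex_def)
    qed
    obtain b where b: "b \<in> \<B>" using assms(3) by blast
    then obtain b' where b': "b' \<in> \<B>'" "c *\<^sub>R b = d *\<^sub>R b'" using eq by blast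
    have "c = d"
      using l1[OF assms(1), of b] l1[OF d(1), of b'] b b' assms(2) d(2) by auto
    then show ?thesis
      using eq assms(1) inj_image_eq_iff[of "\<lambda>x :: real ^ 'e. c *\<^sub>R x" \<B> \<B>']
      by (simp add: inj_on_def)
  qed
  have "{Lip_simplex \<B>' | d \<B>'. 0 < d \<and> \<B>' \<subseteq> unit_simplex \<and>
      (\<lambda>x. c *\<^sub>R x) ` \<B> = (\<lambda>x. d *\<^sub>R x) ` \<B>'} = {Lip_simplex \<B>}"
    using assms uniq by blast
  then show ?thesis by (simp add: Lip_def)
qed

definition vertices :: "(real ^ 'e) set \<Rightarrow> (real ^ 'e) set" where
  "vertices \<B> = {v. v extreme_point_of \<B>}"

definition represents :: "(real ^ 'e) set \<Rightarrow> real ^ 'e \<Rightarrow> (real ^ 'e) pmf \<Rightarrow> bool" where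
  "represents \<B> h \<mu> \<longleftrightarrow>
     set_pmf \<mu> \<subseteq> vertices \<B> \<and> (\<Sum>v\<in>vertices \<B>. pmf \<mu> v *\<^sub>R v) = h"

definition OAT_vertex ::
  "(real ^ 'e) set \<Rightarrow> real ^ 'e \<Rightarrow> real ^ 'e \<Rightarrow> (real ^ 'e) pmf \<Rightarrow> real" where
  "OAT_vertex \<B> h h' \<mu> =
     Inf {(\<Sum>v\<in>vertices \<B>. \<Sum>v'\<in>vertices \<B>. pmf \<kappa> (v, v') * l1_norm (v - v')) | \<mu>' \<kappa>.
       represents \<B> h' \<mu>' \<and> map_pmf fst \<kappa> = \<mu> \<and> map_pmf snd \<kappa> = \<mu>'}"

definition Lip_vertex :: "(real ^ 'e) set \<Rightarrow> ennreal" where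
  "Lip_vertex \<B> = Sup {ennreal (OAT_vertex \<B> h h' \<mu> / l1_norm (h - h')) | h h' \<mu>.
     h \<in> \<B> \<and> h' \<in> \<B> \<and> h \<noteq> h' \<and> represents \<B> h \<mu>}"

end

(* For the first inequality, split every row of \<sigma> into vertices, merge the pieces into one
   distribution \<mu> on vertices, and let any coupling of \<mu> move all rows simultaneously.

   For the second, fix \<mu> with mean h and write L for the depth plus one. Among the couplings \<kappa> of
   \<mu> with cost \<kappa> + L |mean \<kappa> - h'| \<le> L |h - h'| (a compact set) choose one minimising
   |mean \<kappa> - h'|. If this is not 0, there are i with mean_i > h'_i and j with mean_j < h'_j joined by
   at most L basis exchanges a \<rightarrow> b (a leaves and b enters some basis that carries mass). Sending a
   little mass through each of these exchanges moves the mean by \<epsilon> (e_j - e_i) at cost at most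
   2 \<epsilon> L, which contradicts minimality.

   The short path is found by walking backwards from j inside T, the least member containing j that
   is tight for all bases carrying mass. If all elements of B \<inter> A reach j, where the basis B carries
   mass and is tight at A \<subset> T, then some basis B' carrying mass is not tight at A. Augmenting
   B' \<inter> A from B \<inter> A gives an element a whose least B'-tight member A' is strictly larger than A, and all
   elements of B' \<inter> A' reach a in one step. This takes at most as many steps as there are members
   between j and T, and one more exchange enters from i. *)
theory Submission
  imports Defs
begin

section \<open>Bases and tight members of a laminar matroid\<close>

locale laminar_capacities =
  fixes E :: "'e::finite set" and \<A> :: "'e set set" and u :: "'e set \<Rightarrow> nat"
  assumes laminar: "laminar_family E \<A>" and top_member: "E \<in> \<A>"
begin

abbreviation M :: "'e set set" where "M \<equiv> laminar_matroid E \<A> u"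

section \<open>Independent sets, augmentation and bases\<close>

lemma member_nested: "X \<in> \<A> \<Longrightarrow> Y \<in> \<A> \<Longrightarrow> x \<in> X \<Longrightarrow> x \<in> Y \<Longrightarrow> X \<subseteq> Y \<or> Y \<subseteq> X"
  using laminar unfolding laminar_family_def by blast

lemma member_subset: "X \<in> \<A> \<Longrightarrow> X \<subseteq> E"
  using laminar unfolding laminar_family_def by blast

lemma indep_card_le: "I \<in> M \<Longrightarrow> A \<in> \<A> \<Longrightarrow> card (I \<inter> A) \<le> u A"
  unfolding laminar_matroid_def by auto

lemma indep_mono:
  assumes "I \<in> M" "J \<subseteq> I"
  shows "J \<in> M"
proof -
  have "card (J \<inter> A) \<le> u A" if "A \<in> \<A>" for A
  proof -
    have "card (J \<inter> A) \<le> card (I \<inter> A)" using assms(2) by (intro card_mono) auto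
    then show ?thesis using indep_card_le[OF assms(1) that] by simp
  qed
  then show ?thesis using assms unfolding laminar_matroid_def by auto
qed

text \<open>If no element of \<open>J - I\<close> can be added, each of them lies in a member that
  \<open>I\<close> fills to capacity. The maximal such members are pairwise disjoint; in each of
  them \<open>J\<close> has at most as many elements as \<open>I\<close>, and outside them
  \<open>J\<close> is contained in \<open>I\<close>. Hence
  \<open>card J \<le> card I\<close>.\<close>

lemma augmentation:
  assumes I: "I \<in> M" and J: "J \<in> M" and less: "card I < card J"
  shows "\<exists>x\<in>J - I. insert x I \<in> M"
proof (rule ccontr)
  assume contra: "\<not> ?thesis"
  define \<T> where "\<T> = {A \<in> \<A>. card (I \<inter> A) = u A}"
  define \<X> where "\<X> = {A \<in> \<T>. \<forall>C\<in>\<T>. A \<subseteq> C \<longrightarrow> C = A}"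
  have cover: "\<exists>A\<in>\<X>. x \<in> A" if "x \<in> J - I" for x
  proof -
    have "insert x I \<notin> M" "insert x I \<subseteq> E"
      using that contra I J unfolding laminar_matroid_def by auto
    then obtain A where A: "A \<in> \<A>" "card (insert x I \<inter> A) > u A"
      unfolding laminar_matroid_def using not_le by blast
    have xA: "x \<in> A"
    proof (rule ccontr)
      assume "x \<notin> A"
      then have "insert x I \<inter> A = I \<inter> A" by auto
      then show False using A indep_card_le[OF I, of A] by simp
    qed
    then have "card (insert x I \<inter> A) = Suc (card (I \<inter> A))"
      using that by simp
    then have "A \<in> \<T>" using A indep_card_le[OF I, of A] unfolding \<T>_def by simp
    then obtain C where "C \<in> \<T>" "A \<subseteq> C" "\<forall>D\<in>\<T>. C \<subseteq> D \<longrightarrow> D = C"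
      using finite_has_maximal2[of \<T> A] by auto
    then show ?thesis using xA unfolding \<X>_def by auto
  qed
  have disj: "A \<inter> C = {}" if "A \<in> \<X>" "C \<in> \<X>" "A \<noteq> C" for A C
    using that member_nested[of A C] unfolding \<X>_def \<T>_def by blast
  have card_union: "card (K \<inter> \<Union>\<X>) = (\<Sum>A\<in>\<X>. card (K \<inter> A))" for K :: "'e set"
  proof -
    have "card (\<Union>A\<in>\<X>. K \<inter> A) = (\<Sum>A\<in>\<X>. card (K \<inter> A))"
      by (rule card_UN_disjoint) (use disj in \<open>simp, simp, blast\<close>)
    then show ?thesis by simp
  qed
  have "card (J \<inter> A) \<le> card (I \<inter> A)" if "A \<in> \<X>" for A
    using that indep_card_le[OF J, of A] unfolding \<X>_def \<T>_def by auto
  then have "card (J \<inter> \<Union>\<X>) \<le> card (I \<inter> \<Union>\<X>)"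
    unfolding card_union by (rule sum_mono)
  moreover have "card (J - \<Union>\<X>) \<le> card (I - \<Union>\<X>)"
    by (rule card_mono) (use cover in auto)
  ultimately show False
    using less card_Int_Diff[of I "\<Union>\<X>"] card_Int_Diff[of J "\<Union>\<X>"] by simp
qed

lemma basis_indep: "B \<in> bases M \<Longrightarrow> B \<in> M"
  unfolding bases_def by auto

lemma indep_extends_to_basis:
  assumes "I \<in> M"
  shows "\<exists>B\<in>bases M. I \<subseteq> B"
proof -
  obtain B where "B \<in> M" "I \<subseteq> B" "\<And>C. C \<in> M \<Longrightarrow> B \<subseteq> C \<Longrightarrow> B = C"
    using finite_has_maximal2[OF _ assms] by auto
  then show ?thesis unfolding bases_def by blast
qed

lemma indep_card_le_basis:
  assumes "I \<in> M" "B \<in> bases M"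
  shows "card I \<le> card B"
proof (rule ccontr)
  assume "\<not> ?thesis"
  then obtain x where "x \<in> I - B" "insert x B \<in> M"
    using augmentation[OF basis_indep[OF assms(2)] assms(1)] by auto
  then show False using assms(2) unfolding bases_def by auto
qed

lemma bases_card_eq: "B \<in> bases M \<Longrightarrow> B' \<in> bases M \<Longrightarrow> card B = card B'"
  by (rule order_antisym; rule indep_card_le_basis[OF basis_indep])

lemma basis_if_card_eq:
  assumes "I \<in> M" "B \<in> bases M" "card I = card B"
  shows "I \<in> bases M"
proof -
  obtain C where "C \<in> bases M" "I \<subseteq> C" using indep_extends_to_basis[OF assms(1)] by blast
  moreover have "card I = card C" using bases_card_eq[OF assms(2) \<open>C \<in> bases M\<close>] assms(3) by simp
  ultimately show ?thesis using card_subset_eq[of C I] by simp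
qed

lemma bases_nonempty: "bases M \<noteq> {}"
proof -
  have "{} \<in> M" unfolding laminar_matroid_def by auto
  then show ?thesis using indep_extends_to_basis[of "{}"] by blast
qed

lemma basis_subset: "B \<in> bases M \<Longrightarrow> B \<subseteq> E"
  using basis_indep[of B] unfolding laminar_matroid_def by blast

section \<open>Rank, tight sets and basis exchange\<close>

definition rk :: "'e set \<Rightarrow> nat" where
  "rk A = Max ((\<lambda>B. card (B \<inter> A)) ` bases M)"

lemma basis_card_le_rk: "B \<in> bases M \<Longrightarrow> card (B \<inter> A) \<le> rk A"
  unfolding rk_def by (rule Max_ge) auto

lemma indep_card_le_rk:
  assumes "I \<in> M"
  shows "card (I \<inter> A) \<le> rk A"
proof -
  obtain B where B: "B \<in> bases M" "I \<subseteq> B" using indep_extends_to_basis[OF assms] by blast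
  have "card (I \<inter> A) \<le> card (B \<inter> A)" using B(2) by (intro card_mono) auto
  then show ?thesis using basis_card_le_rk[OF B(1), of A] by simp
qed

lemma rk_le_capacity:
  assumes "A \<in> \<A>"
  shows "rk A \<le> u A"
  unfolding rk_def
proof (rule Max.boundedI)
  show "(\<lambda>B. card (B \<inter> A)) ` bases M \<noteq> {}" using bases_nonempty by blast
  show "k \<le> u A" if "k \<in> (\<lambda>B. card (B \<inter> A)) ` bases M" for k
    using that indep_card_le[OF basis_indep assms] by blast
qed simp

text \<open>Tightness compares with the rank and not with the capacity \<open>u A\<close>, which no
  basis need attain. In this way \<open>E\<close> is tight for every basis, and a member that is not
  tight still has slack in its capacity, because \<open>rk A \<le> u A\<close>.\<close>

definition tight :: "'e set \<Rightarrow> 'e set \<Rightarrow> bool" where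
  "tight B A \<longleftrightarrow> card (B \<inter> A) = rk A"

lemma tight_top:
  assumes "B \<in> bases M"
  shows "tight B E"
proof -
  have "card (B' \<inter> E) = card B" if "B' \<in> bases M" for B'
    using bases_card_eq[OF that assms] basis_subset[OF that] by (simp add: Int_absorb2)
  then have "(\<lambda>B. card (B \<inter> E)) ` bases M = (\<lambda>_. card B) ` bases M"
    by (intro image_cong refl)
  then have "(\<lambda>B. card (B \<inter> E)) ` bases M = {card B}"
    using bases_nonempty by (simp add: image_constant_conv)
  then have "rk E = card B" unfolding rk_def by simp
  then show ?thesis using basis_subset[OF assms] unfolding tight_def by (simp add: Int_absorb2)
qed

text \<open>Only members that contain \<open>b\<close> but not \<open>a\<close> gain an element, so
  slack in these keeps the set independent. A swap preserves the cardinality, and an independent set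
  as large as a basis is a basis.\<close>

lemma exchange_basis:
  assumes B: "B \<in> bases M" and a: "a \<in> B" and b: "b \<notin> B" "b \<in> E"
    and ind: "\<And>C. C \<in> \<A> \<Longrightarrow> b \<in> C \<Longrightarrow> a \<notin> C \<Longrightarrow> card (B \<inter> C) < u C"
  shows "insert b (B - {a}) \<in> bases M"
proof (rule basis_if_card_eq[OF _ B])
  show "card (insert b (B - {a})) = card B"
    using a b card_Suc_Diff1[of B a] by simp
  have "card (insert b (B - {a}) \<inter> C) \<le> u C" if C: "C \<in> \<A>" for C
  proof -
    consider "b \<notin> C" | "b \<in> C" "a \<in> C" | "b \<in> C" "a \<notin> C" by blast
    then show ?thesis
    proof cases
      case 1
      then have "card (insert b (B - {a}) \<inter> C) \<le> card (B \<inter> C)"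
        by (intro card_mono) auto
      then show ?thesis using indep_card_le[OF basis_indep[OF B] C] by simp
    next
      case 2
      have "insert b (B - {a}) \<inter> C = insert b ((B \<inter> C) - {a})" using 2 by auto
      then have "card (insert b (B - {a}) \<inter> C) = card (B \<inter> C)"
        using 2 a b card_Suc_Diff1[of "B \<inter> C" a] by simp
      then show ?thesis using indep_card_le[OF basis_indep[OF B] C] by simp
    next
      case 3
      have "insert b (B - {a}) \<inter> C = insert b (B \<inter> C)" using 3 by auto
      then show ?thesis using ind[OF C] 3 b by simp
    qed
  qed
  then show "insert b (B - {a}) \<in> M"
    using b basis_subset[OF B] unfolding laminar_matroid_def by auto
qed

text \<open>A tight member around \<open>b\<close> includes \<open>A\<close> and therefore
  \<open>a\<close>. So the members that gain an element are not tight and have slack.\<close>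

lemma exchange_in_tight:
  assumes "B \<in> bases M" "A \<in> \<A>" "b \<in> A" "b \<notin> B" "a \<in> A" "a \<in> B"
    and min: "\<And>C. C \<in> \<A> \<Longrightarrow> tight B C \<Longrightarrow> b \<in> C \<Longrightarrow> A \<subseteq> C"
  shows "insert b (B - {a}) \<in> bases M"
proof (rule exchange_basis)
  fix C assume C: "C \<in> \<A>" "b \<in> C" "a \<notin> C"
  then have "\<not> tight B C" using min[of C] assms(5) by blast
  then show "card (B \<inter> C) < u C"
    using basis_card_le_rk[OF assms(1), of C] rk_le_capacity[OF C(1)] unfolding tight_def by simp
qed (use assms(1-6) member_subset[OF assms(2)] in blast)+

lemma exchange_between_tight:
  assumes B: "B \<in> bases M" "tight B T" and B': "B' \<in> bases M" "tight B' T"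
    and T: "T \<in> \<A>" and i: "i \<in> T" "i \<in> B" "i \<notin> B'"
  shows "\<exists>a\<in>B' \<inter> T - B. insert a (B - {i}) \<in> bases M"
proof -
  let ?I = "B \<inter> T - {i}"
  have "card ?I < card (B \<inter> T)" using i by (intro psubset_card_mono) auto
  then have "card ?I < card (B' \<inter> T)" using B B' unfolding tight_def by simp
  moreover have "?I \<in> M"
    by (rule indep_mono[OF basis_indep[OF B(1)]]) blast
  moreover have "B' \<inter> T \<in> M"
    by (rule indep_mono[OF basis_indep[OF B'(1)]]) blast
  ultimately obtain a where a: "a \<in> B' \<inter> T - ?I" "insert a ?I \<in> M"
    using augmentation by blast
  then have aB: "a \<notin> B" using i by auto
  have "insert a (B - {i}) \<in> bases M"
  proof (rule exchange_basis)
    fix C assume C: "C \<in> \<A>" "a \<in> C" "i \<notin> C"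
    \<comment> \<open>\<open>C\<close> and \<open>T\<close> share \<open>a\<close>, and
      \<open>i\<close> lies in \<open>T\<close> but not in \<open>C\<close>, so laminarity puts
      \<open>C\<close> inside \<open>T\<close>. There the independence of \<open>insert a ?I\<close>
      already yields the slack.\<close>
    then have "C \<subseteq> T" using member_nested[OF C(1) T, of a] a i by auto
    then have "insert a ?I \<inter> C = insert a (B \<inter> C)" using C by auto
    then show "card (B \<inter> C) < u C"
      using indep_card_le[OF a(2) C(1)] aB by simp
  qed (use B i a aB member_subset[OF T] in blast)+
  then show ?thesis using a aB by auto
qed

text \<open>The tight members containing \<open>b\<close> form a chain, so a minimal one is the
  least.\<close>

lemma least_tight_member:
  assumes "tight B T" "T \<in> \<A>" "b \<in> T"
  obtains A where "A \<in> \<A>" "tight B A" "b \<in> A"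
    "\<And>C. C \<in> \<A> \<Longrightarrow> tight B C \<Longrightarrow> b \<in> C \<Longrightarrow> A \<subseteq> C"
proof -
  let ?F = "{C \<in> \<A>. tight B C \<and> b \<in> C}"
  have "?F \<noteq> {}" using assms by auto
  then obtain A where A: "A \<in> ?F" "\<And>C. C \<in> ?F \<Longrightarrow> C \<subseteq> A \<Longrightarrow> C = A"
    using finite_has_minimal[of ?F] by auto
  have "A \<subseteq> C" if "C \<in> \<A>" "tight B C" "b \<in> C" for C
    using that A member_nested[of A C b] by auto
  then show ?thesis using that[of A] A by auto
qed

text \<open>Only the basis before the exchange has to lie in \<open>S\<close>, later the set of
  bases that carry mass. The steps of a path may use different bases: they are not performed in
  succession on one basis, each shifts its own small amount of mass.\<close>

definition exchange :: "'e set set \<Rightarrow> 'e \<Rightarrow> 'e \<Rightarrow> bool" where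
  "exchange S a b \<longleftrightarrow> (\<exists>B\<in>S. a \<in> B \<and> b \<notin> B \<and> insert b (B - {a}) \<in> bases M)"

end

text \<open>Turns a chain given as a set into the increasing sequence that
  \<open>family_depth\<close> asks for. The induction removes the top set \<open>Y\<close>; the
  remaining sets have a largest one, at which the shorter sequence ends.\<close>

lemma chain_enumeration:
  fixes F :: "'e::finite set set"
  assumes "card F = n" "Y \<in> F" "\<And>X. X \<in> F \<Longrightarrow> X \<subseteq> Y"
    and "\<And>X Z. X \<in> F \<Longrightarrow> Z \<in> F \<Longrightarrow> X \<subseteq> Z \<or> Z \<subseteq> X"
  shows "\<exists>c :: nat \<Rightarrow> 'e set. (\<forall>i\<in>{1..n}. c i \<in> F) \<and> (\<forall>i\<in>{1..<n}. c i \<subset> c (Suc i)) \<and> c n = Y"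
  using assms
proof (induction n arbitrary: F Y)
  case 0
  then have "F = {}" by simp
  with 0 show ?case by simp
next
  case (Suc n)
  show ?case
  proof (cases "n = 0")
    case True
    then show ?thesis using Suc.prems(2) by (intro exI[of _ "\<lambda>_. Y"]) simp
  next
    case False
    let ?G = "F - {Y}"
    have card: "card ?G = n" using Suc.prems(1,2) by simp
    then have "?G \<noteq> {}" using False by (metis card.empty)
    then obtain Z where Z: "Z \<in> ?G" "\<And>X. X \<in> ?G \<Longrightarrow> Z \<subseteq> X \<Longrightarrow> X = Z"
      using finite_has_maximal[of ?G] by auto
    have "X \<subseteq> Z" if "X \<in> ?G" for X
      using Suc.prems(4)[of X Z] Z that by blast
    moreover have "X \<subseteq> W \<or> W \<subseteq> X" if "X \<in> ?G" "W \<in> ?G" for X W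
      using Suc.prems(4)[of X W] that by blast
    ultimately obtain c where c: "\<forall>i\<in>{1..n}. c i \<in> ?G" "\<forall>i\<in>{1..<n}. c i \<subset> c (Suc i)" "c n = Z"
      using Suc.IH[OF card Z(1)] by metis
    have ZY: "Z \<subset> Y" using Z(1) Suc.prems(3)[of Z] by blast
    let ?c = "c(Suc n := Y)"
    have "?c i \<in> F" if "i \<in> {1..Suc n}" for i
    proof (cases "i = Suc n")
      case False
      then have "i \<in> {1..n}" using that by auto
      then show ?thesis using c(1) False by simp
    qed (use Suc.prems(2) in simp)
    moreover have "?c i \<subset> ?c (Suc i)" if "i \<in> {1..<Suc n}" for i
    proof (cases "i = n")
      case False
      then have "i \<in> {1..<n}" using that by auto
      then show ?thesis using c(2) by simp
    qed (use c(3) ZY in simp)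
    moreover have "?c (Suc n) = Y" by simp
    ultimately show ?thesis by (intro exI[of _ ?c]) blast
  qed
qed

section \<open>The depth bound and short exchange paths\<close>

context laminar_capacities
begin

lemma chain_le_depth:
  assumes "F \<subseteq> \<A>" "E \<in> F" "\<And>X Z. X \<in> F \<Longrightarrow> Z \<in> F \<Longrightarrow> X \<subseteq> Z \<or> Z \<subseteq> X"
  shows "card F \<le> family_depth E \<A>"
  unfolding family_depth_def
proof (rule Max_ge)
  let ?L = "{l. 1 \<le> l \<and> (\<exists>c :: nat \<Rightarrow> 'e set. (\<forall>i\<in>{1..l}. c i \<in> \<A>) \<and>
    (\<forall>i\<in>{1..<l}. c i \<subset> c (Suc i)) \<and> c l = E)}"
  \<comment> \<open>Cardinalities increase strictly along the sequence and the first set may be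
    empty, hence the \<open>Suc\<close>. The bound makes the set of lengths finite, as
    \<open>Max\<close> requires.\<close>
  have "l \<le> Suc (card E)" if "l \<in> ?L" for l
  proof -
    from that obtain c :: "nat \<Rightarrow> 'e set" where
      c: "1 \<le> l" "\<forall>i\<in>{1..<l}. c i \<subset> c (Suc i)" "c l = E" by blast
    have "k < Suc (card (c (Suc k)))" if "k < l" for k
      using that
    proof (induction k)
      case (Suc k)
      have "card (c (Suc k)) < card (c (Suc (Suc k)))"
        by (rule psubset_card_mono) (use c(2) Suc.prems in auto)
      then show ?case using Suc.IH Suc.prems by linarith
    qed simp
    from this[of "l - 1"] show ?thesis using c(1,3) by simp
  qed
  then have "?L \<subseteq> {..Suc (card E)}" by blast
  then show "finite ?L" by (rule finite_subset) simp
  have "1 \<le> card F" using assms(2) by (auto simp: Suc_le_eq card_gt_0_iff)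
  have top: "X \<subseteq> E" if "X \<in> F" for X using that assms(1) member_subset[of X] by blast
  obtain c :: "nat \<Rightarrow> 'e set" where "\<forall>i\<in>{1..card F}. c i \<in> F"
    "\<forall>i\<in>{1..<card F}. c i \<subset> c (Suc i)" "c (card F) = E"
    using chain_enumeration[OF refl assms(2) top assms(3)] by metis
  then show "card F \<in> ?L" using assms(1) \<open>1 \<le> card F\<close> by blast
qed

lemma exchange_path:
  assumes S: "S \<subseteq> bases M" and T: "T \<in> \<A>" "j \<in> T" "\<And>B. B \<in> S \<Longrightarrow> tight B T"
    and min: "\<And>A. A \<in> \<A> \<Longrightarrow> j \<in> A \<Longrightarrow> A \<subset> T \<Longrightarrow> \<exists>B\<in>S. \<not> tight B A"
    and j: "B0 \<in> S" "j \<notin> B0" and i: "B1 \<in> S" "i \<in> B1" "i \<in> T"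
  shows "\<exists>m\<le>family_depth E \<A> + 1. (exchange S ^^ m) i j"
proof -
  \<comment> \<open>\<open>N A\<close> is the number of exchanges allowed for reaching
    \<open>j\<close> from inside \<open>A\<close>. It grows strictly with the member
    \<open>A\<close>, which pays for the exchange added when a good member is replaced by a larger
    one.\<close>
  define N where "N A = card {C \<in> \<A>. j \<in> C \<and> C \<subseteq> A}" for A
  define good where "good A \<longleftrightarrow> A \<in> \<A> \<and> j \<in> A \<and> A \<subseteq> T \<and>
    (\<exists>B\<in>S. tight B A \<and> (\<forall>x\<in>A \<inter> B. \<exists>m\<le>N A. (exchange S ^^ m) x j))" for A
  have "\<exists>A. good A"
  proof -
    \<comment> \<open>The walk starts at the least \<open>B0\<close>-tight member around
      \<open>j\<close>: each element of \<open>B0\<close> in it can be exchanged for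
      \<open>j\<close> at once. One exchange is allowed because \<open>A\<close> itself is counted
      in \<open>N A\<close>.\<close>
    obtain A where A: "A \<in> \<A>" "tight B0 A" "j \<in> A"
      "\<And>C. C \<in> \<A> \<Longrightarrow> tight B0 C \<Longrightarrow> j \<in> C \<Longrightarrow> A \<subseteq> C"
      using least_tight_member[OF T(3)[OF j(1)] T(1,2)] by blast
    have "{C \<in> \<A>. j \<in> C \<and> C \<subseteq> A} \<noteq> {}" using A by auto
    then have "1 \<le> N A" unfolding N_def by (simp add: Suc_le_eq card_gt_0_iff)
    have "exchange S x j" if "x \<in> A \<inter> B0" for x
    proof -
      have "insert j (B0 - {x}) \<in> bases M"
        by (rule exchange_in_tight[OF _ A(1,3)]) (use A(4) that S j in auto)
      then show ?thesis using that j unfolding exchange_def by blast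
    qed
    then have "\<exists>m\<le>N A. (exchange S ^^ m) x j" if "x \<in> A \<inter> B0" for x
      using that \<open>1 \<le> N A\<close> relpowp_1[of "exchange S"] by metis
    moreover have "A \<subseteq> T" using A(4)[OF T(1) T(3)[OF j(1)] T(2)] .
    ultimately have "good A" using A(1-3) j(1) unfolding good_def by blast
    then show ?thesis ..
  qed
  then have "Collect good \<noteq> {}" by auto
  then obtain A where A: "good A" and maxA: "\<And>C. good C \<Longrightarrow> A \<subseteq> C \<Longrightarrow> C = A"
    using finite_has_maximal[of "Collect good"] by auto
  from A obtain B where B: "B \<in> S" "tight B A" "\<And>x. x \<in> A \<inter> B \<Longrightarrow> \<exists>m\<le>N A. (exchange S ^^ m) x j"
    unfolding good_def by blast
  have "A = T"
  proof (rule ccontr)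
    assume "A \<noteq> T"
    then obtain B' where B': "B' \<in> S" "\<not> tight B' A" using min[of A] A unfolding good_def by auto
    \<comment> \<open>\<open>B\<close> attains the rank on \<open>A\<close> and \<open>B'\<close>
      does not, so augmentation supplies an element \<open>a\<close> of \<open>B\<close>, from which
      \<open>j\<close> is already reachable, that fits into \<open>B' \<inter> A\<close>.\<close>
    then have "card (B' \<inter> A) < card (B \<inter> A)"
      using basis_card_le_rk[of B' A] B S unfolding tight_def by auto
    moreover have "B' \<inter> A \<in> M"
      by (rule indep_mono[OF basis_indep, of B']) (use B' S in auto)
    moreover have "B \<inter> A \<in> M"
      by (rule indep_mono[OF basis_indep, of B]) (use B S in auto)
    ultimately obtain a where a: "a \<in> B \<inter> A - B' \<inter> A" "insert a (B' \<inter> A) \<in> M"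
      using augmentation by blast
    obtain A' where A': "A' \<in> \<A>" "tight B' A'" "a \<in> A'"
      "\<And>C. C \<in> \<A> \<Longrightarrow> tight B' C \<Longrightarrow> a \<in> C \<Longrightarrow> A' \<subseteq> C"
      using least_tight_member[OF T(3)[OF B'(1)] T(1), of a] a A unfolding good_def by blast
    have aB': "a \<notin> B'" using a(1) by blast
    \<comment> \<open>Inside \<open>A\<close> the tight set \<open>A'\<close> would have no room for
      \<open>a\<close>: the independent set \<open>insert a (B' \<inter> A)\<close> would exceed
      \<open>rk A'\<close> on it.\<close>
    have "\<not> A' \<subseteq> A"
    proof
      assume "A' \<subseteq> A"
      then have "insert a (B' \<inter> A) \<inter> A' = insert a (B' \<inter> A')" using A' by auto
      then show False
        using indep_card_le_rk[OF a(2), of A'] A'(2) aB' unfolding tight_def by simp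
    qed
    then have sub: "A \<subset> A'" using member_nested[of A A' a] A A' a unfolding good_def by auto
    have "{C \<in> \<A>. j \<in> C \<and> C \<subseteq> A} \<subset> {C \<in> \<A>. j \<in> C \<and> C \<subseteq> A'}"
      using sub A A' unfolding good_def by auto
    then have N: "N A < N A'" unfolding N_def by (intro psubset_card_mono) auto
    obtain m where m: "m \<le> N A" "(exchange S ^^ m) a j" using B(3)[of a] a by auto
    \<comment> \<open>Since \<open>A'\<close> is least, every element of \<open>B'\<close> in it can
      be exchanged for \<open>a\<close>. So \<open>A'\<close> is good with \<open>B'\<close> as
      witness.\<close>
    have "exchange S x a" if "x \<in> A' \<inter> B'" for x
    proof -
      have "insert a (B' - {x}) \<in> bases M"
        by (rule exchange_in_tight[OF _ A'(1,3)]) (use A'(4) that aB' S B'(1) in auto)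
      then show ?thesis using that aB' B'(1) unfolding exchange_def by blast
    qed
    then have "(exchange S ^^ Suc m) x j" if "x \<in> A' \<inter> B'" for x
      using relpowp_Suc_I2[OF _ m(2)] that by blast
    moreover have "Suc m \<le> N A'" using m N by simp
    ultimately have "\<exists>m\<le>N A'. (exchange S ^^ m) x j" if "x \<in> A' \<inter> B'" for x
      using that by blast
    moreover have "j \<in> A'" "a \<in> T" using sub A a unfolding good_def by auto
    moreover have "A' \<subseteq> T" using A'(4)[OF T(1) T(3)[OF B'(1)] \<open>a \<in> T\<close>] .
    ultimately have "good A'" using A'(1,2) B'(1) unfolding good_def by blast
    then show False using maxA sub by auto
  qed
  \<comment> \<open>The members containing \<open>j\<close> form a chain with top \<open>E\<close>,
    so the depth bounds their number.\<close>
  have "N T \<le> card {C \<in> \<A>. j \<in> C}" unfolding N_def by (rule card_mono) auto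
  also have "\<dots> \<le> family_depth E \<A>"
  proof (rule chain_le_depth)
    show "E \<in> {C \<in> \<A>. j \<in> C}" using top_member member_subset[OF T(1)] T(2) by auto
    show "X \<subseteq> Z \<or> Z \<subseteq> X" if "X \<in> {C \<in> \<A>. j \<in> C}" "Z \<in> {C \<in> \<A>. j \<in> C}" for X Z
      using member_nested[of X Z j] that by blast
  qed blast
  finally have N: "N T \<le> family_depth E \<A>" .
  show ?thesis
  proof (cases "i \<in> B")
    case True
    then obtain m where "m \<le> N T" "(exchange S ^^ m) i j" using B(3)[of i] i \<open>A = T\<close> by auto
    then show ?thesis using N by (intro exI[of _ m]) auto
  next
    case False
    \<comment> \<open>The elements known to reach \<open>j\<close> are those of \<open>B\<close>. If
      \<open>i\<close> is not among them, an exchange in \<open>B1\<close> first replaces it by one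
      that is; this is the extra step in depth plus one.\<close>
    then obtain a where a: "a \<in> B \<inter> T - B1" "insert a (B1 - {i}) \<in> bases M"
      using exchange_between_tight[OF _ T(3)[OF i(1)] _ T(3)[OF B(1)] T(1) i(3,2)] B(1) i(1) S by blast
    then have "exchange S i a" using i unfolding exchange_def by auto
    moreover obtain m where "m \<le> N T" "(exchange S ^^ m) a j"
      using B(3)[of a] a \<open>A = T\<close> by auto
    ultimately show ?thesis using N relpowp_Suc_I2[of "exchange S" i a m j]
      by (intro exI[of _ "Suc m"]) auto
  qed
qed

end

section \<open>The first inequality\<close>

lemma l1_norm_nonneg: "0 \<le> l1_norm x"
  unfolding l1_norm_def by (rule sum_nonneg) simp

lemma l1_norm_scaleR: "l1_norm (a *\<^sub>R x) = \<bar>a\<bar> * l1_norm x"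
  by (simp add: l1_norm_def abs_mult sum_distrib_left)

lemma l1_norm_0 [simp]: "l1_norm 0 = 0"
  by (simp add: l1_norm_def)

lemma l1_norm_eq_0_iff: "l1_norm x = 0 \<longleftrightarrow> x = 0"
  by (simp add: l1_norm_def sum_nonneg_eq_0_iff vec_eq_iff)

lemma l1_norm_triangle: "l1_norm (x + y) \<le> l1_norm x + l1_norm y"
  unfolding l1_norm_def sum.distrib[symmetric] by (rule sum_mono) (simp add: abs_triangle_ineq)

lemma l1_norm_sum_le: "l1_norm (\<Sum>i\<in>I. f i) \<le> (\<Sum>i\<in>I. l1_norm (f i))"
proof (induction I rule: infinite_finite_induct)
  case (insert i I)
  then show ?case using l1_norm_triangle[of "f i" "sum f I"] by simp
qed simp_all

lemma continuous_on_l1_norm [continuous_intros]: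
  assumes "continuous_on A f"
  shows "continuous_on A (\<lambda>x. l1_norm (f x))"
  unfolding l1_norm_def using assms by (intro continuous_intros)

lemma ex_pmf_finite_support:
  fixes w :: "'a \<Rightarrow> real"
  assumes "finite S" "\<And>x. x \<in> S \<Longrightarrow> 0 \<le> w x" "sum w S = 1"
  shows "\<exists>p. set_pmf p \<subseteq> S \<and> (\<forall>x\<in>S. pmf p x = w x)"
proof -
  define f where "f x = (if x \<in> S then w x else 0)" for x
  have nonneg: "0 \<le> f x" for x using assms(2) by (simp add: f_def)
  have "(\<integral>\<^sup>+x. ennreal (f x) \<partial>count_space UNIV) = (\<Sum>x\<in>S. ennreal (f x))"
    by (rule nn_integral_count_space') (auto simp: f_def assms(1))
  also have "\<dots> = ennreal (sum f S)" using nonneg by simp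
  also have "sum f S = 1" using assms(3) by (simp add: f_def)
  finally have one: "(\<integral>\<^sup>+x. ennreal (f x) \<partial>count_space UNIV) = 1" by simp
  have "set_pmf (embed_pmf f) \<subseteq> S"
    using set_embed_pmf[of f, OF nonneg one] by (auto simp: f_def split: if_splits)
  moreover have "\<forall>x\<in>S. pmf (embed_pmf f) x = w x"
    using pmf_embed_pmf[of f, OF nonneg one] by (simp add: f_def)
  ultimately show ?thesis by blast
qed

lemma pmf_map_eq_sum:
  assumes "finite S" "set_pmf p \<subseteq> S"
  shows "pmf (map_pmf f p) y = (\<Sum>x\<in>S. if f x = y then pmf p x else 0)"
proof -
  have "pmf (map_pmf f p) y = measure (measure_pmf p) (f -` {y})" by (simp add: pmf_map)
  also have "\<dots> = measure (measure_pmf p) {x \<in> S. f x = y}"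
    by (rule measure_pmf.finite_measure_eq_AE) (use assms(2) in \<open>auto simp: AE_measure_pmf_iff\<close>)
  also have "\<dots> = (\<Sum>x\<in>{x \<in> S. f x = y}. pmf p x)"
    using assms(1) by (simp add: measure_measure_pmf_finite)
  also have "\<dots> = (\<Sum>x\<in>S. if f x = y then pmf p x else 0)"
    using assms(1) by (simp add: sum.inter_filter)
  finally show ?thesis .
qed

lemma coupling_marginals:
  assumes V: "finite V" "set_pmf \<kappa> \<subseteq> V \<times> V"
  shows "v \<in> V \<Longrightarrow> (\<Sum>v'\<in>V. pmf \<kappa> (v, v')) = pmf (map_pmf fst \<kappa>) v"
    and "v' \<in> V \<Longrightarrow> (\<Sum>v\<in>V. pmf \<kappa> (v, v')) = pmf (map_pmf snd \<kappa>) v'"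
proof -
  have fin: "finite (V \<times> V)" using V(1) by simp
  show "(\<Sum>v'\<in>V. pmf \<kappa> (v, v')) = pmf (map_pmf fst \<kappa>) v" if "v \<in> V"
  proof -
    have "pmf (map_pmf fst \<kappa>) v = (\<Sum>x\<in>V. \<Sum>y\<in>V. if x = v then pmf \<kappa> (x, y) else 0)"
      unfolding pmf_map_eq_sum[OF fin V(2)] sum.cartesian_product by (intro sum.cong) auto
    also have "\<dots> = (\<Sum>x\<in>V. if x = v then \<Sum>y\<in>V. pmf \<kappa> (x, y) else 0)"
      by (intro sum.cong) auto
    finally show ?thesis using that V(1) by simp
  qed
  show "(\<Sum>v\<in>V. pmf \<kappa> (v, v')) = pmf (map_pmf snd \<kappa>) v'" if "v' \<in> V"
  proof -
    have "pmf (map_pmf snd \<kappa>) v' = (\<Sum>x\<in>V. \<Sum>y\<in>V. if y = v' then pmf \<kappa> (x, y) else 0)"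
      unfolding pmf_map_eq_sum[OF fin V(2)] sum.cartesian_product by (intro sum.cong) auto
    then show ?thesis using that V(1) by simp
  qed
qed

lemma sum_rotate: "(\<Sum>p\<in>P. \<Sum>v\<in>A. \<Sum>w\<in>B. f p v w) = (\<Sum>v\<in>A. \<Sum>w\<in>B. \<Sum>p\<in>P. f p v w)"
  unfolding sum.swap[of _ A P] by (intro sum.cong refl sum.swap)

section \<open>From rows to distributions on vertices\<close>

lemma polytope_vertices:
  assumes "polytope C"
  shows "finite (vertices C)" "C = convex hull vertices C"
proof -
  show "finite (vertices C)"
    unfolding vertices_def
    using finite_polyhedron_extreme_points[OF polytope_imp_polyhedron[OF assms]] .
  show "C = convex hull vertices C"
    unfolding vertices_def
    using Krein_Milman_Minkowski[OF polytope_imp_compact polytope_imp_convex] assms by blast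
qed

lemma ex_represents:
  assumes "polytope C" "h \<in> C"
  shows "\<exists>\<mu>. represents C h \<mu>"
proof -
  have "h \<in> convex hull vertices C" using polytope_vertices(2)[OF assms(1)] assms(2) by blast
  then obtain w where w: "\<forall>v\<in>vertices C. 0 \<le> w v" "sum w (vertices C) = 1"
    "(\<Sum>v\<in>vertices C. w v *\<^sub>R v) = h"
    unfolding convex_hull_finite[OF polytope_vertices(1)[OF assms(1)]] by blast
  obtain \<mu> where \<mu>: "set_pmf \<mu> \<subseteq> vertices C" "\<forall>v\<in>vertices C. pmf \<mu> v = w v"
    using ex_pmf_finite_support[OF polytope_vertices(1)[OF assms(1)], of w] w by blast
  have "(\<Sum>v\<in>vertices C. pmf \<mu> v *\<^sub>R v) = h"
    unfolding w(3)[symmetric] by (intro sum.cong) (use \<mu>(2) in auto)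
  then show ?thesis using \<mu>(1) unfolding represents_def by blast
qed

text \<open>One \<mu> serves all couplings: row \<open>p\<close> contributes its mass times its
  vertex weights. A coupling of \<mu> is shared out among the rows in proportion to their parts of
  each vertex, which keeps all row masses. By the triangle inequality the rows then move by at most
  the coupling cost, divided by \<open>c\<close> because the vertices belong to the scaled
  polytope.\<close>

lemma OAT_le_OAT_vertex:
  fixes \<B> C :: "(real ^ 'e) set"
  assumes C: "polytope C" "C = (\<lambda>x. c *\<^sub>R x) ` \<B>" and c: "0 < c" and simplex: "\<B> \<subseteq> unit_simplex"
    and h': "h' \<in> \<B>" and alloc: "allocates n \<B> h \<sigma>" and total: "(\<Sum>p<n. l1_norm (\<sigma> p)) = 1"
  shows "\<exists>\<mu>. represents C (c *\<^sub>R h) \<mu> \<and>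
    OAT n \<B> h h' \<sigma> \<le> OAT_vertex C (c *\<^sub>R h) (c *\<^sub>R h') \<mu> / c"
proof -
  define V where "V = vertices C"
  have V: "finite V" "C = convex hull V"
    unfolding V_def using polytope_vertices[OF C(1)] by blast+
  define s where "s p = l1_norm (\<sigma> p)" for p
  have s_nonneg: "0 \<le> s p" for p unfolding s_def by (rule l1_norm_nonneg)
  \<comment> \<open>Multiplying by \<open>s p\<close> instead of normalising the row also covers
    rows of mass 0.\<close>
  have "\<exists>w. (\<forall>v\<in>V. 0 \<le> w v) \<and> sum w V = 1 \<and> s p *\<^sub>R (\<Sum>v\<in>V. w v *\<^sub>R v) = c *\<^sub>R \<sigma> p"
    if p: "p < n" for p
  proof -
    obtain x where x: "x \<in> \<B>" "\<sigma> p = s p *\<^sub>R x"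
      using alloc p unfolding allocates_def s_def by blast
    then have "c *\<^sub>R x \<in> convex hull V" using C(2) V(2) by blast
    then obtain w where "\<forall>v\<in>V. 0 \<le> w v" "sum w V = 1" "(\<Sum>v\<in>V. w v *\<^sub>R v) = c *\<^sub>R x"
      unfolding convex_hull_finite[OF V(1)] by blast
    then show ?thesis using x(2) by (intro exI[of _ w]) simp
  qed
  then have "\<forall>p\<in>{..<n}. \<exists>w. (\<forall>v\<in>V. 0 \<le> w v) \<and> sum w V = 1 \<and>
      s p *\<^sub>R (\<Sum>v\<in>V. w v *\<^sub>R v) = c *\<^sub>R \<sigma> p"
    by simp
  from bchoice[OF this] obtain w where "\<forall>p\<in>{..<n}. (\<forall>v\<in>V. 0 \<le> w p v) \<and> sum (w p) V = 1 \<and>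
      s p *\<^sub>R (\<Sum>v\<in>V. w p v *\<^sub>R v) = c *\<^sub>R \<sigma> p" ..
  then have w: "\<And>p v. p < n \<Longrightarrow> v \<in> V \<Longrightarrow> 0 \<le> w p v" "\<And>p. p < n \<Longrightarrow> sum (w p) V = 1"
    "\<And>p. p < n \<Longrightarrow> s p *\<^sub>R (\<Sum>v\<in>V. w p v *\<^sub>R v) = c *\<^sub>R \<sigma> p"
    by simp_all
  define m where "m v = (\<Sum>p<n. s p * w p v)" for v
  have m_nonneg: "0 \<le> m v" if "v \<in> V" for v
    unfolding m_def by (rule sum_nonneg) (use w(1) s_nonneg that in simp)
  have "sum m V = (\<Sum>p<n. s p * sum (w p) V)"
    unfolding m_def sum_distrib_left by (rule sum.swap)
  also have "\<dots> = 1" using w(2) total by (simp add: s_def)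
  finally obtain \<mu> where \<mu>: "set_pmf \<mu> \<subseteq> V" "\<And>v. v \<in> V \<Longrightarrow> pmf \<mu> v = m v"
    using ex_pmf_finite_support[OF V(1), of m] m_nonneg by blast
  have "(\<Sum>v\<in>V. pmf \<mu> v *\<^sub>R v) = (\<Sum>v\<in>V. \<Sum>p<n. (s p * w p v) *\<^sub>R v)"
    using \<mu>(2) by (simp add: m_def scaleR_left.sum)
  also have "\<dots> = (\<Sum>p<n. \<Sum>v\<in>V. (s p * w p v) *\<^sub>R v)" by (rule sum.swap)
  also have "\<dots> = (\<Sum>p<n. s p *\<^sub>R (\<Sum>v\<in>V. w p v *\<^sub>R v))" by (simp add: scaleR_sum_right)
  also have "\<dots> = c *\<^sub>R (\<Sum>p<n. \<sigma> p)" using w(3) by (simp add: scaleR_sum_right)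
  also have "\<dots> = c *\<^sub>R h" using alloc unfolding allocates_def by simp
  finally have rep: "represents C (c *\<^sub>R h) \<mu>" using \<mu>(1) unfolding represents_def V_def by blast
  have bound: "OAT n \<B> h h' \<sigma> * c \<le> (\<Sum>v\<in>V. \<Sum>v'\<in>V. pmf \<kappa> (v, v') * l1_norm (v - v'))"
    if \<mu>': "represents C (c *\<^sub>R h') \<mu>'" and \<kappa>: "map_pmf fst \<kappa> = \<mu>" "map_pmf snd \<kappa> = \<mu>'" for \<mu>' \<kappa>
  proof -
    have "set_pmf \<mu>' \<subseteq> V" using \<mu>' unfolding represents_def V_def by blast
    then have "set_pmf \<kappa> \<subseteq> V \<times> V" using \<kappa> \<mu>(1) by force
    note marg = coupling_marginals[OF V(1) this, unfolded \<kappa>]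
    \<comment> \<open>The mass that row \<open>p\<close> sends from \<open>v\<close> to
      \<open>v'\<close>: the row owns the fraction \<open>s p * w p v / m v\<close> of the mass at
      \<open>v\<close>. If \<open>m v = 0\<close>, the quotient is 0 by convention, which is right
      since no row then has mass at \<open>v\<close>.\<close>
    define q where "q p v v' = s p * w p v * pmf \<kappa> (v, v') / m v" for p v v'
    have q_nonneg: "0 \<le> q p v v'" if "p < n" "v \<in> V" for p v v'
      unfolding q_def using s_nonneg w(1) m_nonneg that by simp
    have q_row: "(\<Sum>v'\<in>V. q p v v') = s p * w p v" if "p < n" "v \<in> V" for p v
    proof -
      have "(\<Sum>v'\<in>V. q p v v') = s p * w p v * (\<Sum>v'\<in>V. pmf \<kappa> (v, v')) / m v"
        unfolding q_def by (simp add: sum_distrib_left sum_divide_distrib)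
      also have "\<dots> = s p * w p v * m v / m v" using marg(1) \<mu>(2) that(2) by simp
      also have "\<dots> = s p * w p v"
      proof (cases "m v = 0")
        case True
        then have "s p * w p v = 0"
          unfolding m_def using sum_nonneg_eq_0_iff[of "{..<n}" "\<lambda>p. s p * w p v"] that w(1) s_nonneg
          by simp
        then show ?thesis by (simp only: mult_zero_left div_0)
      qed simp
      finally show ?thesis .
    qed
    have q_col: "(\<Sum>p<n. q p v v') = pmf \<kappa> (v, v')" if "v \<in> V" "v' \<in> V" for v v'
    proof -
      have "(\<Sum>p<n. q p v v') = m v * pmf \<kappa> (v, v') / m v"
        unfolding q_def m_def by (simp add: sum_distrib_right sum_divide_distrib)
      \<comment> \<open>A vertex without mass sends nothing, so the convention for division by 0 is
        harmless here too.\<close>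
      moreover have "pmf \<kappa> (v, v') = 0" if "m v = 0"
      proof -
        have "(\<Sum>v'\<in>V. pmf \<kappa> (v, v')) = 0" using marg(1)[OF \<open>v \<in> V\<close>] \<mu>(2)[OF \<open>v \<in> V\<close>] that by simp
        then show ?thesis using V(1) \<open>v' \<in> V\<close> by (simp add: sum_nonneg_eq_0_iff)
      qed
      ultimately show ?thesis by (cases "m v = 0") simp_all
    qed
    define \<sigma>' where "\<sigma>' p = (1 / c) *\<^sub>R (\<Sum>v\<in>V. \<Sum>v'\<in>V. q p v v' *\<^sub>R v')" for p
    have in_scaled: "\<exists>b\<in>\<B>. \<sigma>' p = s p *\<^sub>R b" if p: "p < n" for p
    proof (cases "s p = 0")
      case True
      then have "\<sigma>' p = 0" unfolding \<sigma>'_def q_def by simp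
      then show ?thesis using True h' by auto
    next
      case False
      \<comment> \<open>The normalised distribution of the row over its target vertices; its mean
        lies in the polytope. A row of mass 0 was handled above with \<open>h'\<close> as an
        arbitrary point of \<open>\<B>\<close>.\<close>
      define r where "r v' = (\<Sum>v\<in>V. q p v v') / s p" for v'
      have "0 \<le> r v'" for v'
        unfolding r_def using q_nonneg[OF p] s_nonneg by (simp add: sum_nonneg)
      moreover have "sum r V = 1"
      proof -
        have "sum r V = (\<Sum>v\<in>V. \<Sum>v'\<in>V. q p v v') / s p"
          unfolding r_def sum_divide_distrib[symmetric] by (subst sum.swap) simp
        also have "\<dots> = (\<Sum>v\<in>V. s p * w p v) / s p" using q_row[OF p] by simp
        also have "\<dots> = 1" using w(2)[OF p] False by (simp add: sum_distrib_left[symmetric])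
        finally show ?thesis .
      qed
      ultimately have "(\<Sum>v'\<in>V. r v' *\<^sub>R v') \<in> convex hull V"
        unfolding convex_hull_finite[OF V(1)] by blast
      then obtain b where b: "b \<in> \<B>" "(\<Sum>v'\<in>V. r v' *\<^sub>R v') = c *\<^sub>R b" using V(2) C(2) by blast
      have "s p *\<^sub>R (\<Sum>v'\<in>V. r v' *\<^sub>R v') = (\<Sum>v'\<in>V. \<Sum>v\<in>V. q p v v' *\<^sub>R v')"
        unfolding r_def scaleR_sum_right using False by (simp add: scaleR_left.sum)
      also have "\<dots> = (\<Sum>v\<in>V. \<Sum>v'\<in>V. q p v v' *\<^sub>R v')" by (rule sum.swap)
      finally have "\<sigma>' p = (1 / c) *\<^sub>R s p *\<^sub>R c *\<^sub>R b" unfolding \<sigma>'_def b(2) by simp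
      then show ?thesis using b(1) c by auto
    qed
    have l1_\<sigma>': "l1_norm (\<sigma>' p) = s p" if "p < n" for p
      using in_scaled[OF that] simplex s_nonneg[of p]
      by (auto simp: l1_norm_scaleR unit_simplex_def)
    have nonneg: "0 \<le> \<sigma>' p $ i" if "p < n" for p i
      using in_scaled[OF that] simplex s_nonneg[of p] by (auto simp: unit_simplex_def)
    have "(\<Sum>p<n. \<sigma>' p) = (1 / c) *\<^sub>R (\<Sum>p<n. \<Sum>v\<in>V. \<Sum>v'\<in>V. q p v v' *\<^sub>R v')"
      unfolding \<sigma>'_def by (simp add: scaleR_sum_right)
    also have "(\<Sum>p<n. \<Sum>v\<in>V. \<Sum>v'\<in>V. q p v v' *\<^sub>R v') = (\<Sum>v\<in>V. \<Sum>v'\<in>V. \<Sum>p<n. q p v v' *\<^sub>R v')"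
      by (rule sum_rotate)
    also have "\<dots> = (\<Sum>v\<in>V. \<Sum>v'\<in>V. pmf \<kappa> (v, v') *\<^sub>R v')"
      using q_col by (simp add: scaleR_left.sum[symmetric])
    also have "\<dots> = (\<Sum>v'\<in>V. \<Sum>v\<in>V. pmf \<kappa> (v, v') *\<^sub>R v')" by (rule sum.swap)
    also have "\<dots> = (\<Sum>v'\<in>V. pmf \<mu>' v' *\<^sub>R v')"
      using marg(2) by (simp add: scaleR_left.sum[symmetric])
    also have "\<dots> = c *\<^sub>R h'" using \<mu>' unfolding represents_def V_def by blast
    finally have "(\<Sum>p<n. \<sigma>' p) = h'" using c by simp
    then have alloc': "allocates n \<B> h' \<sigma>'"
      unfolding allocates_def using nonneg in_scaled l1_\<sigma>' by (simp add: image_iff)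
    have "OAT n \<B> h h' \<sigma> \<le> (\<Sum>p<n. l1_norm (\<sigma> p - \<sigma>' p))"
      unfolding OAT_def
    proof (rule cInf_lower)
      show "bdd_below {(\<Sum>p<n. l1_norm (\<sigma> p - \<sigma>' p)) |\<sigma>'.
          allocates n \<B> h' \<sigma>' \<and> (\<forall>p<n. l1_norm (\<sigma>' p) = l1_norm (\<sigma> p))}"
        by (rule bdd_belowI[of _ 0]) (auto intro!: sum_nonneg l1_norm_nonneg)
    qed (use alloc' l1_\<sigma>' in \<open>auto simp: s_def\<close>)
    also have "\<dots> \<le> (\<Sum>p<n. (1 / c) * (\<Sum>v\<in>V. \<Sum>v'\<in>V. q p v v' * l1_norm (v - v')))"
    proof (rule sum_mono)
      fix p assume "p \<in> {..<n}"
      then have p: "p < n" by simp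
      have "c *\<^sub>R \<sigma> p = (\<Sum>v\<in>V. (\<Sum>v'\<in>V. q p v v') *\<^sub>R v)"
        unfolding w(3)[OF p, symmetric] scaleR_sum_right using q_row[OF p] by simp
      then have "\<sigma> p = (1 / c) *\<^sub>R (\<Sum>v\<in>V. \<Sum>v'\<in>V. q p v v' *\<^sub>R v)"
        using c by (simp add: scaleR_left.sum[symmetric] flip: \<open>c *\<^sub>R \<sigma> p = _\<close>)
      \<comment> \<open>Both rows are sums with the same weights \<open>q\<close>, over the sources
        and over the targets, so they can be subtracted term by term.\<close>
      then have "\<sigma> p - \<sigma>' p = (1 / c) *\<^sub>R (\<Sum>v\<in>V. \<Sum>v'\<in>V. q p v v' *\<^sub>R (v - v'))"
        unfolding \<sigma>'_def by (simp add: scaleR_diff_right sum_subtractf)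
      then have "l1_norm (\<sigma> p - \<sigma>' p) = (1 / c) * l1_norm (\<Sum>v\<in>V. \<Sum>v'\<in>V. q p v v' *\<^sub>R (v - v'))"
        using c by (simp add: l1_norm_scaleR)
      moreover have "l1_norm (\<Sum>v\<in>V. \<Sum>v'\<in>V. q p v v' *\<^sub>R (v - v')) \<le>
          (\<Sum>v\<in>V. \<Sum>v'\<in>V. q p v v' * l1_norm (v - v'))"
      proof (intro order_trans[OF l1_norm_sum_le] sum_mono)
        fix v v' assume "v \<in> V" "v' \<in> V"
        then show "l1_norm (q p v v' *\<^sub>R (v - v')) \<le> q p v v' * l1_norm (v - v')"
          using q_nonneg[OF p] by (simp add: l1_norm_scaleR)
      qed
      ultimately show "l1_norm (\<sigma> p - \<sigma>' p) \<le>
          (1 / c) * (\<Sum>v\<in>V. \<Sum>v'\<in>V. q p v v' * l1_norm (v - v'))"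
        using c by (simp add: divide_right_mono)
    qed
    also have "\<dots> = (1 / c) * (\<Sum>p<n. \<Sum>v\<in>V. \<Sum>v'\<in>V. q p v v' * l1_norm (v - v'))"
      by (simp add: sum_distrib_left)
    also have "(\<Sum>p<n. \<Sum>v\<in>V. \<Sum>v'\<in>V. q p v v' * l1_norm (v - v')) =
        (\<Sum>v\<in>V. \<Sum>v'\<in>V. \<Sum>p<n. q p v v' * l1_norm (v - v'))"
      by (rule sum_rotate)
    also have "\<dots> = (\<Sum>v\<in>V. \<Sum>v'\<in>V. pmf \<kappa> (v, v') * l1_norm (v - v'))"
      using q_col by (simp add: sum_distrib_right[symmetric])
    finally show ?thesis using c by (simp add: field_simps)
  qed
  have "OAT n \<B> h h' \<sigma> * c \<le> OAT_vertex C (c *\<^sub>R h) (c *\<^sub>R h') \<mu>"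
    unfolding OAT_vertex_def
  proof (rule cInf_greatest)
    have "c *\<^sub>R h' \<in> C" using C(2) h' by blast
    then obtain \<mu>' where "represents C (c *\<^sub>R h') \<mu>'" using ex_represents[OF C(1)] by blast
    \<comment> \<open>The product coupling shows that the infimum is not taken over the empty
      set.\<close>
    moreover have "map_pmf fst (pair_pmf \<mu> \<mu>') = \<mu>" "map_pmf snd (pair_pmf \<mu> \<mu>') = \<mu>'"
      by (simp_all add: map_fst_pair_pmf map_snd_pair_pmf)
    ultimately show "{\<Sum>v\<in>vertices C. \<Sum>v'\<in>vertices C. pmf \<kappa> (v, v') * l1_norm (v - v') |\<mu>' \<kappa>.
        represents C (c *\<^sub>R h') \<mu>' \<and> map_pmf fst \<kappa> = \<mu> \<and> map_pmf snd \<kappa> = \<mu>'} \<noteq> {}" by blast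
  next
    fix x
    assume "x \<in> {\<Sum>v\<in>vertices C. \<Sum>v'\<in>vertices C. pmf \<kappa> (v, v') * l1_norm (v - v') |\<mu>' \<kappa>.
        represents C (c *\<^sub>R h') \<mu>' \<and> map_pmf fst \<kappa> = \<mu> \<and> map_pmf snd \<kappa> = \<mu>'}"
    then show "OAT n \<B> h h' \<sigma> * c \<le> x" using bound unfolding V_def by blast
  qed
  then show ?thesis using rep c by (auto simp: pos_le_divide_eq)
qed

theorem Lip_le_Lip_vertex:
  fixes C :: "(real ^ 'e) set"
  assumes "polytope C"
  shows "Lip C \<le> Lip_vertex C"
proof -
  have "ennreal (OAT n \<B> h h' \<sigma> / l1_norm (h - h')) \<le> Lip_vertex C"
    if c: "0 < c" "\<B> \<subseteq> unit_simplex" "C = (\<lambda>x. c *\<^sub>R x) ` \<B>"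
      and h: "h \<in> \<B>" "h' \<in> \<B>" "h \<noteq> h'"
      and \<sigma>: "allocates n \<B> h \<sigma>" "(\<Sum>p<n. l1_norm (\<sigma> p)) = 1" for c \<B> n h h' \<sigma>
  proof -
    obtain \<mu> where \<mu>: "represents C (c *\<^sub>R h) \<mu>"
      "OAT n \<B> h h' \<sigma> \<le> OAT_vertex C (c *\<^sub>R h) (c *\<^sub>R h') \<mu> / c"
      using OAT_le_OAT_vertex[OF assms c(3,1,2) h(2) \<sigma>] by blast
    have "l1_norm (c *\<^sub>R h - c *\<^sub>R h') = c * l1_norm (h - h')"
      using c(1) l1_norm_scaleR[of c "h - h'"] by (simp add: scaleR_diff_right)
    \<comment> \<open>Cost and distance carry the same factor \<open>c\<close>, so the quotient does
      not change under scaling.\<close>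
    then have "OAT n \<B> h h' \<sigma> / l1_norm (h - h') \<le>
        OAT_vertex C (c *\<^sub>R h) (c *\<^sub>R h') \<mu> / l1_norm (c *\<^sub>R h - c *\<^sub>R h')"
      using divide_right_mono[OF \<mu>(2) l1_norm_nonneg[of "h - h'"]] by (simp add: mult.commute)
    moreover have "c *\<^sub>R h \<in> C" "c *\<^sub>R h' \<in> C" "c *\<^sub>R h \<noteq> c *\<^sub>R h'" using c h by auto
    then have "ennreal (OAT_vertex C (c *\<^sub>R h) (c *\<^sub>R h') \<mu> / l1_norm (c *\<^sub>R h - c *\<^sub>R h')) \<le> Lip_vertex C"
      unfolding Lip_vertex_def using \<mu>(1) by (intro Sup_upper) blast
    ultimately show ?thesis by (meson ennreal_leI order_trans)
  qed
  \<comment> \<open>If no pair \<open>(c, \<B>)\<close> exists, as in rank 0, the left side is the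
    supremum of the empty set, which is 0.\<close>
  then show ?thesis unfolding Lip_def Lip_simplex_def by (intro Sup_least) (auto intro!: Sup_least)
qed

section \<open>Exchange paths between points of the polytope\<close>

lemma indicator_vec_nth: "indicator_vec S $ i = of_bool (i \<in> S)"
  by (simp add: indicator_vec_def indicator_def)

lemma inj_indicator_vec: "inj (indicator_vec :: 'e::finite set \<Rightarrow> real ^ 'e)"
  by (rule injI) (simp add: vec_eq_iff indicator_vec_nth of_bool_eq_iff set_eq_iff)

lemma indicator_vec_exchange:
  assumes "a \<in> B" "b \<notin> B"
  shows "indicator_vec (insert b (B - {a})) = indicator_vec B + axis b 1 - axis a 1"
  using assms by (auto simp: vec_eq_iff indicator_vec_nth axis_def)

lemma sum_indicator_vec: "(\<Sum>e\<in>A. indicator_vec B $ e) = real (card (B \<inter> A))"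
  for A B :: "'e::finite set"
  by (simp add: indicator_vec_nth of_bool_def sum.If_cases Int_commute Int_def)

text \<open>The hull lies in the unit cube. Since 0 and 1 are extreme in the unit interval, a 0/1
  vector strictly between two points of the cube agrees with both in every coordinate. Hence no
  generator is lost as a vertex, and distributions on vertices are distributions on bases.\<close>

lemma vertices_indicator_hull:
  fixes X :: "'e::finite set set"
  shows "vertices (convex hull (indicator_vec ` X)) = indicator_vec ` X" (is "vertices ?P = _")
proof
  show "vertices ?P \<subseteq> indicator_vec ` X"
    unfolding vertices_def using extreme_point_of_convex_hull by blast
  have box: "0 \<le> x $ i \<and> x $ i \<le> 1" if "x \<in> ?P" for x :: "real ^ 'e" and i
  proof -
    have "?P \<subseteq> {x. \<forall>i. 0 \<le> x $ i \<and> x $ i \<le> 1}"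
    proof (rule hull_minimal)
      show "convex {x :: real ^ 'e. \<forall>i. 0 \<le> x $ i \<and> x $ i \<le> 1}"
        unfolding convex_def
        by (auto intro!: convex_bound_le add_nonneg_nonneg mult_nonneg_nonneg)
    qed (auto simp: indicator_vec_nth)
    then show ?thesis using that by blast
  qed
  show "indicator_vec ` X \<subseteq> vertices ?P"
  proof
    fix x :: "real ^ 'e" assume "x \<in> indicator_vec ` X"
    then obtain B where B: "x = indicator_vec B" "x \<in> ?P" by (auto intro: hull_inc)
    have "x \<notin> open_segment a b" if ab: "a \<in> ?P" "b \<in> ?P" for a b
    proof
      assume "x \<in> open_segment a b"
      then obtain t where t: "a \<noteq> b" "0 < t" "t < 1" "x = (1 - t) *\<^sub>R a + t *\<^sub>R b"
        unfolding in_segment by blast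
      have "a $ i = b $ i" for i
      proof -
        have xi: "of_bool (i \<in> B) = (1 - t) * a $ i + t * b $ i"
          using t(4) B(1) indicator_vec_nth[of B i] by simp
        note bnd = box[OF ab(1), of i] box[OF ab(2), of i]
        show ?thesis
        proof (cases "i \<in> B")
          case True
          have "(1 - t) * (1 - a $ i) + t * (1 - b $ i) = 0"
            using xi True by (simp add: algebra_simps)
          moreover have "0 \<le> (1 - t) * (1 - a $ i)" "0 \<le> t * (1 - b $ i)" using bnd t by simp_all
          ultimately have "(1 - t) * (1 - a $ i) = 0" "t * (1 - b $ i) = 0" by linarith+
          then show ?thesis using t by simp
        next
          case False
          have "0 \<le> (1 - t) * a $ i" "0 \<le> t * b $ i" using bnd t by simp_all
          moreover have "(1 - t) * a $ i + t * b $ i = 0" using xi False by simp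
          ultimately have "(1 - t) * a $ i = 0" "t * b $ i = 0" by linarith+
          then show ?thesis using t by simp
        qed
      qed
      then show False using t(1) by (simp add: vec_eq_iff)
    qed
    then show "x \<in> vertices ?P" using B(2) unfolding vertices_def extreme_point_of_def by blast
  qed
qed

lemma indicator_hull_weights:
  fixes X :: "'e::finite set set"
  assumes "h \<in> convex hull (indicator_vec ` X)"
  shows "\<exists>w. (\<forall>B\<in>X. 0 \<le> w B) \<and> sum w X = 1 \<and> h = (\<Sum>B\<in>X. w B *\<^sub>R indicator_vec B)"
proof -
  obtain w where w: "\<forall>v\<in>indicator_vec ` X. 0 \<le> w v" "sum w (indicator_vec ` X) = 1"
    "(\<Sum>v\<in>indicator_vec ` X. w v *\<^sub>R v) = h"
    using assms unfolding convex_hull_finite[OF finite_imageI[OF finite_class.finite[of X]]] by blast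
  have inj: "inj_on (indicator_vec :: 'e set \<Rightarrow> real ^ 'e) X"
    using inj_indicator_vec by (rule inj_on_subset) simp
  show ?thesis
    by (rule exI[of _ "w \<circ> indicator_vec"]) (use w in \<open>auto simp: sum.reindex[OF inj]\<close>)
qed

context laminar_capacities
begin

text \<open>On a set that is tight for all bases carrying mass, \<open>h\<close> attains the rank,
  and \<open>h'\<close> can never exceed it. So a deficit of \<open>h\<close> at \<open>j\<close> is
  balanced by an excess at some \<open>i\<close> in the least such member \<open>T\<close> around
  \<open>j\<close>.\<close>

lemma exchange_path_between:
  assumes w: "\<And>B. B \<in> bases M \<Longrightarrow> 0 \<le> w B" "sum w (bases M) = 1"
    and h: "h = (\<Sum>B\<in>bases M. w B *\<^sub>R indicator_vec B)"
    and h': "h' \<in> basis_polytope M" and ne: "h \<noteq> h'"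
  shows "\<exists>i j m. h' $ i < h $ i \<and> h $ j < h' $ j \<and> m \<le> family_depth E \<A> + 1 \<and>
    (exchange {B \<in> bases M. 0 < w B} ^^ m) i j"
proof -
  define S where "S = {B \<in> bases M. 0 < w B}"
  obtain w' where w': "\<And>B. B \<in> bases M \<Longrightarrow> 0 \<le> w' B" "sum w' (bases M) = 1"
    "h' = (\<Sum>B\<in>bases M. w' B *\<^sub>R indicator_vec B)"
    using indicator_hull_weights[OF h'[unfolded basis_polytope_def]] by blast
  have mass: "(\<Sum>e\<in>A. (\<Sum>B\<in>bases M. v B *\<^sub>R indicator_vec B) $ e) =
      (\<Sum>B\<in>bases M. v B * real (card (B \<inter> A)))" for v and A :: "'e set"
  proof -
    have "(\<Sum>e\<in>A. (\<Sum>B\<in>bases M. v B *\<^sub>R indicator_vec B) $ e) =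
        (\<Sum>B\<in>bases M. \<Sum>e\<in>A. v B * indicator_vec B $ e)"
      by (simp add: sum_component) (rule sum.swap)
    then show ?thesis by (simp add: sum_distrib_left[symmetric] sum_indicator_vec)
  qed
  have mass_tight: "(\<Sum>e\<in>A. h $ e) = real (rk A)" if "\<And>B. B \<in> S \<Longrightarrow> tight B A" for A
  proof -
    have "w B * real (card (B \<inter> A)) = w B * real (rk A)" if "B \<in> bases M" for B
    proof (cases "w B = 0")
      case False
      then have "B \<in> S" using w(1)[OF that] that unfolding S_def by simp
      then show ?thesis using \<open>\<And>B. B \<in> S \<Longrightarrow> tight B A\<close>[of B] unfolding tight_def by simp
    qed simp
    then have "(\<Sum>e\<in>A. h $ e) = (\<Sum>B\<in>bases M. w B * real (rk A))"
      unfolding h mass by (intro sum.cong refl) blast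
    then show ?thesis using w(2) by (simp add: sum_distrib_right[symmetric])
  qed
  have mass'_le: "(\<Sum>e\<in>A. h' $ e) \<le> real (rk A)" for A
  proof -
    have "(\<Sum>e\<in>A. h' $ e) \<le> (\<Sum>B\<in>bases M. w' B * real (rk A))"
      unfolding w'(3) mass by (intro sum_mono mult_left_mono) (auto simp: w'(1) basis_card_le_rk)
    then show ?thesis using w'(2) by (simp add: sum_distrib_right[symmetric])
  qed
  obtain B\<^sub>0 where B\<^sub>0: "B\<^sub>0 \<in> bases M" using bases_nonempty by blast
  \<comment> \<open>All bases have the same size, so \<open>h\<close> and \<open>h'\<close> have
    equal coordinate sums. Being different, they leave some coordinate of \<open>h\<close> below
    that of \<open>h'\<close>.\<close>
  have total: "(\<Sum>e\<in>UNIV. (\<Sum>B\<in>bases M. v B *\<^sub>R indicator_vec B) $ e) = real (card B\<^sub>0)"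
    if "sum v (bases M) = 1" for v
  proof -
    have "(\<Sum>B\<in>bases M. v B * real (card (B \<inter> UNIV))) = (\<Sum>B\<in>bases M. v B * real (card B\<^sub>0))"
      by (intro sum.cong refl) (use bases_card_eq[OF B\<^sub>0] in simp)
    then show ?thesis unfolding mass using that by (simp add: sum_distrib_right[symmetric])
  qed
  have "\<exists>j. h $ j < h' $ j"
  proof (rule ccontr)
    assume "\<not> ?thesis"
    then have le: "h' $ j \<le> h $ j" for j by (simp add: not_less)
    have "(\<Sum>e\<in>UNIV. h $ e - h' $ e) = 0"
      unfolding sum_subtractf using total[OF w(2)] total[OF w'(2)] h w'(3) by simp
    then have "h = h'" using le by (simp add: sum_nonneg_eq_0_iff vec_eq_iff)
    then show False using ne by simp
  qed
  then obtain j where j: "h $ j < h' $ j" ..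
  have h_nth: "(\<Sum>B\<in>bases M. v B *\<^sub>R indicator_vec B) $ e = (\<Sum>B\<in>bases M. v B * of_bool (e \<in> B))"
    for v and e :: 'e
    by (simp add: sum_component indicator_vec_nth)
  have h_nonneg: "0 \<le> h $ e" "0 \<le> h' $ e" for e
    unfolding h w'(3) h_nth by (intro sum_nonneg; simp add: w(1) w'(1))+
  have h'_le: "h' $ j \<le> 1"
    unfolding w'(3) h_nth w'(2)[symmetric] by (intro sum_mono) (simp add: w'(1))
  have jE: "j \<in> E"
  proof (rule ccontr)
    assume "j \<notin> E"
    then have "w' B * of_bool (j \<in> B) = 0" if "B \<in> bases M" for B using basis_subset[OF that] by auto
    then have "h' $ j = 0" unfolding w'(3) h_nth by (intro sum.neutral ballI)
    then show False using j h_nonneg(1)[of j] by simp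
  qed
  \<comment> \<open>Otherwise \<open>h\<close> would have the value 1 at \<open>j\<close>, but it is
    smaller there than \<open>h'\<close>, whose coordinates are at most 1.\<close>
  have "\<exists>B\<in>S. j \<notin> B"
  proof (rule ccontr)
    assume "\<not> ?thesis"
    then have "w B * of_bool (j \<in> B) = w B" if "B \<in> bases M" for B
      using w(1)[OF that] that unfolding S_def by (cases "w B = 0") auto
    then have "h $ j = sum w (bases M)" unfolding h h_nth by (intro sum.cong refl)
    then have "h $ j = 1" using w(2) by simp
    then show False using j h'_le by simp
  qed
  then obtain B0 where B0: "B0 \<in> S" "j \<notin> B0" ..
  have S: "S \<subseteq> bases M" unfolding S_def by blast
  let ?F = "{A \<in> \<A>. j \<in> A \<and> (\<forall>B\<in>S. tight B A)}"
  \<comment> \<open>\<open>E\<close> belongs to the family, as it is tight for every basis.\<close>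
  have "?F \<noteq> {}" using top_member jE tight_top S by blast
  then have "\<exists>T\<in>?F. \<forall>A\<in>?F. A \<subseteq> T \<longrightarrow> T = A"
    by (rule finite_has_minimal[OF finite_class.finite])
  then obtain T where T: "T \<in> ?F" and T_min: "\<forall>A\<in>?F. A \<subseteq> T \<longrightarrow> T = A" ..
  have min: "\<exists>B\<in>S. \<not> tight B A" if "A \<in> \<A>" "j \<in> A" "A \<subset> T" for A
  proof (rule ccontr)
    assume "\<not> ?thesis"
    then have "A \<in> ?F" using that by blast
    then show False using T_min that(3) by blast
  qed
  have "\<exists>i\<in>T. h' $ i < h $ i"
  proof (rule ccontr)
    assume "\<not> ?thesis"
    then have "(\<Sum>e\<in>T. h $ e) < (\<Sum>e\<in>T. h' $ e)"
      using T j by (intro sum_strict_mono_ex1) (auto simp: not_less)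
    then show False using mass_tight[of T] mass'_le[of T] T by simp
  qed
  then obtain i where i: "i \<in> T" "h' $ i < h $ i" ..
  have "\<exists>B\<in>S. i \<in> B"
  proof (rule ccontr)
    assume "\<not> ?thesis"
    then have "w B * of_bool (i \<in> B) = 0" if "B \<in> bases M" for B
      using w(1)[OF that] that unfolding S_def by (cases "w B = 0") auto
    then have "h $ i = 0" unfolding h h_nth by (intro sum.neutral ballI)
    then show False using i(2) h_nonneg(2)[of i] by simp
  qed
  then obtain B1 where B1: "B1 \<in> S" "i \<in> B1" ..
  have "\<exists>m\<le>family_depth E \<A> + 1. (exchange S ^^ m) i j"
    by (rule exchange_path[OF S _ _ _ min B0 B1 i(1)]) (use T in auto)
  then show ?thesis using i(2) j unfolding S_def by blast
qed

end

section \<open>Couplings of basis distributions\<close>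

text \<open>Couplings are vectors indexed by all pairs of sets, so that cost and mean are linear on
  a Euclidean space. This admits signed directions and makes compactness available.\<close>

definition coupling_cost :: "real ^ ('e::finite set \<times> 'e set) \<Rightarrow> real" where
  "coupling_cost \<kappa> = (\<Sum>p\<in>UNIV. \<kappa> $ p * l1_norm (indicator_vec (fst p) - indicator_vec (snd p)))"

definition coupling_mean :: "real ^ ('e::finite set \<times> 'e set) \<Rightarrow> real ^ 'e" where
  "coupling_mean \<kappa> = (\<Sum>p\<in>UNIV. \<kappa> $ p *\<^sub>R indicator_vec (snd p))"

lemma linear_coupling_cost: "linear coupling_cost"
  by (rule linearI) (simp_all add: coupling_cost_def algebra_simps sum.distrib sum_distrib_left)

lemma linear_coupling_mean: "linear coupling_mean"
  by (rule linearI) (simp_all add: coupling_mean_def algebra_simps sum.distrib scaleR_sum_right)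

lemma coupling_cost_axis:
  "coupling_cost (axis (R, B) 1) = l1_norm (indicator_vec R - indicator_vec B)"
proof -
  have "coupling_cost (axis (R, B) 1) = (\<Sum>p\<in>UNIV. if p = (R, B)
      then l1_norm (indicator_vec (fst p) - indicator_vec (snd p)) else 0)"
    unfolding coupling_cost_def by (intro sum.cong) (auto simp: axis_def)
  then show ?thesis by simp
qed

lemma coupling_mean_axis: "coupling_mean (axis (R, B) 1) = indicator_vec B"
proof -
  have "coupling_mean (axis (R, B) 1) = (\<Sum>p\<in>UNIV. if p = (R, B) then indicator_vec (snd p) else 0)"
    unfolding coupling_mean_def by (intro sum.cong) (auto simp: axis_def)
  then show ?thesis by simp
qed

lemma l1_norm_axis: "l1_norm (axis e a) = \<bar>a\<bar>"
proof -
  have "l1_norm (axis e a) = (\<Sum>k\<in>UNIV. if k = e then \<bar>a\<bar> else 0)"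
    unfolding l1_norm_def by (intro sum.cong) (auto simp: axis_def)
  then show ?thesis by simp
qed

lemma sum_axis_row:
  "(\<Sum>B'\<in>UNIV. axis (R, B) (1::real) $ (R', B')) = of_bool (R' = R)" for B :: "'e::finite set"
proof -
  have "(\<Sum>B'\<in>UNIV. axis (R, B) (1::real) $ (R', B')) = (\<Sum>B'\<in>UNIV. if B' = B then of_bool (R' = R) else 0)"
    by (intro sum.cong) (auto simp: axis_def)
  then show ?thesis by simp
qed

text \<open>Neither coordinate crosses 0, so both absolute values drop by exactly
  \<epsilon>.\<close>

lemma l1_norm_move_towards:
  fixes x :: "real ^ 'e::finite"
  assumes "0 \<le> \<epsilon>" "\<epsilon> \<le> x $ i" "x $ j \<le> - \<epsilon>" "i \<noteq> j"
  shows "l1_norm (x + \<epsilon> *\<^sub>R (axis j 1 - axis i 1)) = l1_norm x - 2 * \<epsilon>"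
proof -
  have "l1_norm (x + \<epsilon> *\<^sub>R (axis j 1 - axis i 1)) =
      (\<Sum>k\<in>UNIV. \<bar>x $ k\<bar> - (if k = i then \<epsilon> else 0) - (if k = j then \<epsilon> else 0))"
    unfolding l1_norm_def by (intro sum.cong) (use assms in \<open>auto simp: axis_def\<close>)
  then show ?thesis by (simp add: sum_subtractf l1_norm_def)
qed

lemma ex_step_keeping_nonneg:
  fixes \<kappa> \<Delta> :: "real ^ 'n::finite"
  assumes "\<And>p. 0 \<le> \<kappa> $ p" "\<And>p. \<kappa> $ p = 0 \<Longrightarrow> 0 \<le> \<Delta> $ p"
  shows "\<exists>\<epsilon>>0. \<forall>t. 0 \<le> t \<longrightarrow> t \<le> \<epsilon> \<longrightarrow> (\<forall>p. 0 \<le> \<kappa> $ p + t * \<Delta> $ p)"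
proof -
  \<comment> \<open>Where \<open>\<kappa> $ p = 0\<close>, every step length is safe and 1 is an
    arbitrary choice. Elsewhere the added 1 keeps the denominator positive.\<close>
  define b where "b p = (if \<kappa> $ p = 0 then 1 else \<kappa> $ p / (\<bar>\<Delta> $ p\<bar> + 1))" for p
  have b_pos: "0 < b p" for p using assms(1)[of p] by (auto simp: b_def)
  have "0 \<le> \<kappa> $ p + t * \<Delta> $ p" if "0 \<le> t" "t \<le> b p" for p t
  proof (cases "\<kappa> $ p = 0")
    case False
    have "t * \<bar>\<Delta> $ p\<bar> \<le> t * (\<bar>\<Delta> $ p\<bar> + 1)" using that(1) by (intro mult_left_mono) auto
    also have "\<dots> \<le> \<kappa> $ p" using that(2) False by (simp add: b_def pos_le_divide_eq)
    finally have "\<bar>t * \<Delta> $ p\<bar> \<le> \<kappa> $ p" using that(1) by (simp add: abs_mult)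
    then show ?thesis by linarith
  qed (use assms(2) that in simp)
  moreover have "0 < Min (range b)" using b_pos by simp
  moreover have "Min (range b) \<le> b p" for p by simp
  ultimately show ?thesis by (intro exI[of _ "Min (range b)"]) (meson order_trans)
qed

section \<open>Improving a coupling along exchange paths\<close>

context laminar_capacities
begin

text \<open>An exchange of \<open>a\<close> for \<open>b\<close> in \<open>B\<close> moves one unit
  from the entry \<open>(R, B)\<close> to \<open>(R, B')\<close>. Row sums stay the same, the mean
  changes by \<open>axis b 1 - axis a 1\<close>, and the cost rises by at most 2; along the path the
  changes of the mean telescope. Units are taken only from positive entries of \<kappa>, so a small
  multiple of the sum can be added to \<kappa>.\<close>

lemma exchange_path_direction:
  fixes \<kappa> :: "real ^ ('e set \<times> 'e set)"
  assumes "(exchange {B \<in> bases M. \<exists>R. 0 < \<kappa> $ (R, B)} ^^ m) a j"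
  shows "\<exists>\<Delta>. (\<forall>p. \<kappa> $ p = 0 \<longrightarrow> 0 \<le> \<Delta> $ p) \<and> (\<forall>R B. B \<notin> bases M \<longrightarrow> \<Delta> $ (R, B) = 0) \<and>
    (\<forall>R. (\<Sum>B\<in>UNIV. \<Delta> $ (R, B)) = 0) \<and> coupling_mean \<Delta> = axis j 1 - axis a 1 \<and>
    coupling_cost \<Delta> \<le> 2 * real m"
  using assms
proof (induction m arbitrary: a)
  case 0
  then have "a = j" by simp
  then show ?case
    by (intro exI[of _ 0]) (simp add: linear_0[OF linear_coupling_mean] linear_0[OF linear_coupling_cost])
next
  case (Suc m)
  then obtain b where ab: "exchange {B \<in> bases M. \<exists>R. 0 < \<kappa> $ (R, B)} a b"
    and path: "(exchange {B \<in> bases M. \<exists>R. 0 < \<kappa> $ (R, B)} ^^ m) b j"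
    by (meson relpowp_Suc_D2)
  obtain \<Delta> where \<Delta>: "\<forall>p. \<kappa> $ p = 0 \<longrightarrow> 0 \<le> \<Delta> $ p" "\<forall>R B. B \<notin> bases M \<longrightarrow> \<Delta> $ (R, B) = 0"
    "\<forall>R. (\<Sum>B\<in>UNIV. \<Delta> $ (R, B)) = 0" "coupling_mean \<Delta> = axis j 1 - axis b 1"
    "coupling_cost \<Delta> \<le> 2 * real m"
    using Suc.IH[OF path] by blast
  obtain R B where B: "B \<in> bases M" "0 < \<kappa> $ (R, B)" "a \<in> B" "b \<notin> B" "insert b (B - {a}) \<in> bases M"
    using ab unfolding exchange_def by blast
  define B' where "B' = insert b (B - {a})"
  define \<Delta>' where "\<Delta>' = \<Delta> + (axis (R, B') 1 - axis (R, B) 1)"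
  have ind: "indicator_vec B' = indicator_vec B + axis b 1 - axis a 1"
    unfolding B'_def by (rule indicator_vec_exchange[OF B(3,4)])
  have "0 \<le> \<Delta>' $ p" if "\<kappa> $ p = 0" for p
  proof -
    have "p \<noteq> (R, B)" using B(2) that by auto
    then show ?thesis using \<Delta>(1)[rule_format, OF that] by (simp add: \<Delta>'_def axis_def)
  qed
  moreover have "\<Delta>' $ (Q, C) = 0" if "C \<notin> bases M" for Q C
    using \<Delta>(2) that B(1,5) by (auto simp: \<Delta>'_def axis_def B'_def)
  moreover have "(\<Sum>C\<in>UNIV. \<Delta>' $ (Q, C)) = 0" for Q
    using \<Delta>(3) by (simp add: \<Delta>'_def sum.distrib sum_subtractf sum_axis_row)
  moreover have "coupling_mean \<Delta>' = axis j 1 - axis a 1"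
    unfolding \<Delta>'_def
    by (simp add: linear_add[OF linear_coupling_mean] linear_diff[OF linear_coupling_mean]
        coupling_mean_axis ind \<Delta>(4))
  moreover have "coupling_cost \<Delta>' \<le> 2 * real (Suc m)"
  proof -
    have "indicator_vec R - indicator_vec B' =
        (indicator_vec R - indicator_vec B) + (axis a 1 + axis b (-1))"
      unfolding ind by (auto simp: vec_eq_iff axis_def)
    then have "l1_norm (indicator_vec R - indicator_vec B') \<le>
        l1_norm (indicator_vec R - indicator_vec B) + l1_norm (axis a 1 + axis b (-1) :: real ^ 'e)"
      by (simp only: l1_norm_triangle)
    moreover have "l1_norm (axis a 1 + axis b (-1) :: real ^ 'e) \<le> 2"
      using l1_norm_triangle[of "axis a 1 :: real ^ 'e" "axis b (-1)"] by (simp add: l1_norm_axis)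
    ultimately show ?thesis
      unfolding \<Delta>'_def using \<Delta>(5)
      by (simp add: linear_add[OF linear_coupling_cost] linear_diff[OF linear_coupling_cost]
          coupling_cost_axis)
  qed
  ultimately show ?case by (intro exI[of _ \<Delta>']) blast
qed

text \<open>Only the first marginal is prescribed. The second may be spread over the bases in any
  way, and its mean is what gets driven to \<open>h'\<close>.\<close>

definition coupling_from :: "('e set \<Rightarrow> real) \<Rightarrow> real ^ ('e set \<times> 'e set) \<Rightarrow> bool" where
  "coupling_from m \<kappa> \<longleftrightarrow> (\<forall>p. 0 \<le> \<kappa> $ p) \<and> (\<forall>R B. B \<notin> bases M \<longrightarrow> \<kappa> $ (R, B) = 0) \<and>
    (\<forall>R. (\<Sum>B\<in>UNIV. \<kappa> $ (R, B)) = m R)"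

text \<open>The rate matters: each unit of cost beyond the old one is matched by a decrease of the
  distance, with ratio at most the depth plus one.\<close>

lemma coupling_improvement:
  assumes \<kappa>: "coupling_from m \<kappa>" and m: "sum m UNIV = 1"
    and h': "h' \<in> basis_polytope M" and ne: "coupling_mean \<kappa> \<noteq> h'"
  shows "\<exists>\<kappa>' \<epsilon>. coupling_from m \<kappa>' \<and> 0 < \<epsilon> \<and>
    l1_norm (coupling_mean \<kappa>' - h') = l1_norm (coupling_mean \<kappa> - h') - 2 * \<epsilon> \<and>
    coupling_cost \<kappa>' \<le> coupling_cost \<kappa> + 2 * \<epsilon> * real (family_depth E \<A> + 1)"
proof -
  note nonneg = \<kappa>[unfolded coupling_from_def, THEN conjunct1, rule_format]
    and supp = \<kappa>[unfolded coupling_from_def, THEN conjunct2, THEN conjunct1, rule_format]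
    and row = \<kappa>[unfolded coupling_from_def, THEN conjunct2, THEN conjunct2, rule_format]
  \<comment> \<open>The second marginal, whose mean is
    \<open>coupling_mean \<kappa>\<close>.\<close>
  define w where "w B = (\<Sum>R\<in>UNIV. \<kappa> $ (R, B))" for B
  have w_nonneg: "0 \<le> w B" for B unfolding w_def by (rule sum_nonneg) (rule nonneg)
  have w_supp: "w B = 0" if "B \<notin> bases M" for B unfolding w_def using supp[OF that] by simp
  have "sum w (bases M) = sum w UNIV"
    by (rule sum.mono_neutral_left) (use w_supp in auto)
  also have "\<dots> = 1" unfolding w_def by (subst sum.swap) (simp add: row m)
  finally have w_sum: "sum w (bases M) = 1" .
  have "coupling_mean \<kappa> = (\<Sum>R\<in>UNIV. \<Sum>B\<in>UNIV. \<kappa> $ (R, B) *\<^sub>R indicator_vec B)"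
    unfolding coupling_mean_def UNIV_Times_UNIV[symmetric] sum.cartesian_product
    by (intro sum.cong) auto
  also have "\<dots> = (\<Sum>B\<in>UNIV. w B *\<^sub>R indicator_vec B)"
    unfolding w_def scaleR_left.sum by (rule sum.swap)
  also have "\<dots> = (\<Sum>B\<in>bases M. w B *\<^sub>R indicator_vec B)"
    by (rule sum.mono_neutral_right) (use w_supp in auto)
  finally have mean: "coupling_mean \<kappa> = (\<Sum>B\<in>bases M. w B *\<^sub>R indicator_vec B)" .
  \<comment> \<open>Entries are nonnegative, so a column has positive sum exactly if it has a
    positive entry. This identifies the two descriptions of the bases that carry mass.\<close>
  have "0 < w B \<longleftrightarrow> (\<exists>R. 0 < \<kappa> $ (R, B))" for B
  proof
    assume "0 < w B"
    show "\<exists>R. 0 < \<kappa> $ (R, B)"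
    proof (rule ccontr)
      assume "\<not> ?thesis"
      then have "\<kappa> $ (R, B) = 0" for R using nonneg[of "(R, B)"] by (simp add: not_less order_antisym)
      then show False using \<open>0 < w B\<close> unfolding w_def by simp
    qed
  next
    assume "\<exists>R. 0 < \<kappa> $ (R, B)"
    then show "0 < w B" unfolding w_def by (metis UNIV_I finite_class.finite nonneg sum_pos2)
  qed
  then have S: "{B \<in> bases M. 0 < w B} = {B \<in> bases M. \<exists>R. 0 < \<kappa> $ (R, B)}" by blast
  obtain i j k where ij: "h' $ i < coupling_mean \<kappa> $ i" "coupling_mean \<kappa> $ j < h' $ j"
    and k: "k \<le> family_depth E \<A> + 1"
    and path: "(exchange {B \<in> bases M. \<exists>R. 0 < \<kappa> $ (R, B)} ^^ k) i j"
    using exchange_path_between[OF w_nonneg w_sum mean h' ne] unfolding S by blast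
  obtain \<Delta> where \<Delta>: "\<forall>p. \<kappa> $ p = 0 \<longrightarrow> 0 \<le> \<Delta> $ p" "\<forall>R B. B \<notin> bases M \<longrightarrow> \<Delta> $ (R, B) = 0"
    "\<forall>R. (\<Sum>B\<in>UNIV. \<Delta> $ (R, B)) = 0" "coupling_mean \<Delta> = axis j 1 - axis i 1"
    "coupling_cost \<Delta> \<le> 2 * real k"
    using exchange_path_direction[OF path] by blast
  obtain \<delta> where \<delta>: "0 < \<delta>" "\<forall>t. 0 \<le> t \<longrightarrow> t \<le> \<delta> \<longrightarrow> (\<forall>p. 0 \<le> \<kappa> $ p + t * \<Delta> $ p)"
    using ex_step_keeping_nonneg[of \<kappa> \<Delta>] nonneg \<Delta>(1) by blast
  define x where "x = coupling_mean \<kappa> - h'"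
  \<comment> \<open>The bound \<delta> keeps the entries nonnegative; the other two prevent the mean
    from passing \<open>h'\<close> at \<open>i\<close> and at \<open>j\<close>.\<close>
  define \<epsilon> where "\<epsilon> = min \<delta> (min (x $ i) (- x $ j))"
  have \<epsilon>: "0 < \<epsilon>" "\<epsilon> \<le> \<delta>" "\<epsilon> \<le> x $ i" "x $ j \<le> - \<epsilon>"
    using \<delta>(1) ij unfolding \<epsilon>_def x_def by auto
  define \<kappa>' where "\<kappa>' = \<kappa> + \<epsilon> *\<^sub>R \<Delta>"
  have "coupling_from m \<kappa>'"
    unfolding coupling_from_def
  proof (intro conjI allI impI)
    show "0 \<le> \<kappa>' $ p" for p
      using \<delta>(2)[rule_format, of \<epsilon> p] \<epsilon>(1,2) by (simp add: \<kappa>'_def)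
    show "\<kappa>' $ (R, B) = 0" if "B \<notin> bases M" for R B
      using supp[OF that] \<Delta>(2) that by (simp add: \<kappa>'_def)
    show "(\<Sum>B\<in>UNIV. \<kappa>' $ (R, B)) = m R" for R
      using row[of R] \<Delta>(3) by (simp add: \<kappa>'_def sum.distrib sum_distrib_left[symmetric])
  qed
  moreover have "l1_norm (coupling_mean \<kappa>' - h') = l1_norm (coupling_mean \<kappa> - h') - 2 * \<epsilon>"
  proof -
    have "coupling_mean \<kappa>' - h' = x + \<epsilon> *\<^sub>R (axis j 1 - axis i 1)"
      unfolding \<kappa>'_def x_def
      by (simp add: linear_add[OF linear_coupling_mean] linear_cmul[OF linear_coupling_mean] \<Delta>(4))
    moreover have "i \<noteq> j" using ij by auto
    then have "l1_norm (x + \<epsilon> *\<^sub>R (axis j 1 - axis i 1)) = l1_norm x - 2 * \<epsilon>"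
      using \<epsilon> by (intro l1_norm_move_towards) auto
    ultimately show ?thesis unfolding x_def by (simp only:)
  qed
  moreover have "coupling_cost \<kappa>' \<le> coupling_cost \<kappa> + 2 * \<epsilon> * real (family_depth E \<A> + 1)"
  proof -
    have "coupling_cost \<kappa>' = coupling_cost \<kappa> + \<epsilon> * coupling_cost \<Delta>"
      unfolding \<kappa>'_def by (simp add: linear_add[OF linear_coupling_cost] linear_cmul[OF linear_coupling_cost])
    also have "\<epsilon> * coupling_cost \<Delta> \<le> \<epsilon> * (2 * real (family_depth E \<A> + 1))"
      using \<Delta>(5) k \<epsilon>(1) by (intro mult_left_mono) auto
    finally show ?thesis by (simp add: mult.assoc mult.left_commute)
  qed
  ultimately show ?thesis using \<epsilon>(1) by blast
qed

lemma transport_coupling: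
  assumes m: "\<And>R. 0 \<le> m R" "sum m UNIV = 1" "\<And>R. R \<notin> bases M \<Longrightarrow> m R = 0"
    and h: "h = (\<Sum>R\<in>UNIV. m R *\<^sub>R indicator_vec R)" and h': "h' \<in> basis_polytope M"
  shows "\<exists>\<kappa>. coupling_from m \<kappa> \<and> coupling_mean \<kappa> = h' \<and>
    coupling_cost \<kappa> \<le> real (family_depth E \<A> + 1) * l1_norm (h - h')"
proof -
  define L where "L = real (family_depth E \<A> + 1)"
  \<comment> \<open>The inequality holds with equality for the coupling that leaves all mass in
    place, and it becomes the claim once the distance to \<open>h'\<close> is 0.\<close>
  define K where "K = {\<kappa>. coupling_from m \<kappa> \<and>
    coupling_cost \<kappa> + L * l1_norm (coupling_mean \<kappa> - h') \<le> L * l1_norm (h - h')}"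
  have cont: "continuous_on A coupling_cost" "continuous_on A coupling_mean" for A
    using linear_continuous_on linear_coupling_cost linear_coupling_mean
    by (auto simp: linear_conv_bounded_linear)
  have "closed K"
    unfolding K_def coupling_from_def
    by (intro closed_Collect_conj closed_Collect_all closed_Collect_imp closed_Collect_le
        closed_Collect_eq continuous_intros cont) auto
  moreover have "bounded K"
  proof (rule bounded_subset[OF bounded_cbox])
    have "\<kappa> $ (R, B) \<le> 1" if "coupling_from m \<kappa>" for \<kappa> R B
    proof -
      have nonneg: "0 \<le> \<kappa> $ p" for p using that unfolding coupling_from_def by blast
      have "\<kappa> $ (R, B) \<le> (\<Sum>B\<in>UNIV. \<kappa> $ (R, B))"
        by (rule member_le_sum) (use nonneg in auto)
      also have "\<dots> = m R" using that unfolding coupling_from_def by blast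
      also have "\<dots> \<le> sum m UNIV" by (rule member_le_sum) (use m(1) in auto)
      finally show ?thesis using m(2) by simp
    qed
    then show "K \<subseteq> cbox 0 1"
      unfolding K_def by (auto simp: mem_box_cart coupling_from_def)
  qed
  ultimately have "compact K" by (simp add: compact_eq_bounded_closed)
  moreover have "K \<noteq> {}"
  proof -
    \<comment> \<open>The diagonal coupling: cost 0 and mean \<open>h\<close>.\<close>
    define \<kappa> :: "real ^ ('e set \<times> 'e set)" where "\<kappa> = (\<chi> p. if fst p = snd p then m (fst p) else 0)"
    have "coupling_from m \<kappa>"
      using m(1,3) by (auto simp: coupling_from_def \<kappa>_def)
    moreover have "coupling_cost \<kappa> = 0"
      unfolding coupling_cost_def by (intro sum.neutral) (auto simp: \<kappa>_def)
    moreover have "coupling_mean \<kappa> = h"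
    proof -
      have "coupling_mean \<kappa> = (\<Sum>R\<in>UNIV. \<Sum>B\<in>UNIV. \<kappa> $ (R, B) *\<^sub>R indicator_vec B)"
        unfolding coupling_mean_def UNIV_Times_UNIV[symmetric] sum.cartesian_product
        by (intro sum.cong) auto
      also have "\<dots> = (\<Sum>R\<in>UNIV. \<Sum>B\<in>UNIV. if B = R then m R *\<^sub>R indicator_vec R else 0)"
        by (intro sum.cong refl) (auto simp: \<kappa>_def)
      finally show ?thesis unfolding h by simp
    qed
    ultimately have "\<kappa> \<in> K" unfolding K_def by simp
    then show ?thesis by blast
  qed
  moreover have "continuous_on K (\<lambda>\<kappa>. l1_norm (coupling_mean \<kappa> - h'))"
    by (intro continuous_intros cont)
  ultimately obtain \<kappa> where \<kappa>: "\<kappa> \<in> K"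
    "\<And>\<kappa>'. \<kappa>' \<in> K \<Longrightarrow> l1_norm (coupling_mean \<kappa> - h') \<le> l1_norm (coupling_mean \<kappa>' - h')"
    using continuous_attains_inf[of K "\<lambda>\<kappa>. l1_norm (coupling_mean \<kappa> - h')"] by blast
  have "coupling_mean \<kappa> = h'"
  proof (rule ccontr)
    assume "coupling_mean \<kappa> \<noteq> h'"
    then obtain \<kappa>' \<epsilon> where \<kappa>': "coupling_from m \<kappa>'" "0 < \<epsilon>"
      "l1_norm (coupling_mean \<kappa>' - h') = l1_norm (coupling_mean \<kappa> - h') - 2 * \<epsilon>"
      "coupling_cost \<kappa>' \<le> coupling_cost \<kappa> + 2 * \<epsilon> * L"
      using coupling_improvement[OF _ m(2) h', of \<kappa>] \<kappa>(1) unfolding K_def L_def by blast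
    \<comment> \<open>The distance drops by \<open>2 * \<epsilon>\<close> while the cost rises by at
      most \<open>2 * \<epsilon> * L\<close>, so the new coupling stays in \<open>K\<close> and is
      closer to \<open>h'\<close>.\<close>
    have "coupling_cost \<kappa>' + L * l1_norm (coupling_mean \<kappa>' - h') \<le>
        coupling_cost \<kappa> + L * l1_norm (coupling_mean \<kappa> - h')"
      unfolding \<kappa>'(3) using \<kappa>'(4) by (simp add: algebra_simps)
    then have "\<kappa>' \<in> K" using \<kappa>(1) \<kappa>'(1) unfolding K_def by simp
    then show False using \<kappa>(2)[of \<kappa>'] \<kappa>'(2,3) by simp
  qed
  then show ?thesis using \<kappa>(1) unfolding K_def L_def by auto
qed

text \<open>Carries the optimal coupling of basis weights over to distributions on vertices, along
  the injective map \<open>indicator_vec\<close>.\<close>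

lemma OAT_vertex_le:
  assumes \<mu>: "represents (basis_polytope M) h \<mu>" and h': "h' \<in> basis_polytope M"
  shows "OAT_vertex (basis_polytope M) h h' \<mu> \<le> real (family_depth E \<A> + 1) * l1_norm (h - h')"
proof -
  let ?P = "basis_polytope M" and ?ind = "indicator_vec :: 'e set \<Rightarrow> real ^ 'e"
  have V: "vertices ?P = ?ind ` bases M"
    unfolding basis_polytope_def by (rule vertices_indicator_hull)
  have inj: "inj_on ?ind X" for X using inj_indicator_vec by (rule inj_on_subset) simp
  have supp: "set_pmf \<mu> \<subseteq> ?ind ` bases M" and
    mean: "h = (\<Sum>R\<in>bases M. pmf \<mu> (?ind R) *\<^sub>R ?ind R)"
    using \<mu> unfolding represents_def V by (auto simp: sum.reindex[OF inj])
  define m where "m R = pmf \<mu> (?ind R)" for R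
  have m_supp: "m R = 0" if "R \<notin> bases M" for R
  proof -
    have "?ind R \<notin> ?ind ` bases M" using that by (simp add: inj_image_mem_iff[OF inj_indicator_vec])
    then show ?thesis unfolding m_def using supp by (auto simp: set_pmf_iff)
  qed
  have "sum m UNIV = sum m (bases M)" by (rule sum.mono_neutral_right) (use m_supp in auto)
  also have "\<dots> = sum (pmf \<mu>) (?ind ` bases M)" unfolding m_def by (simp add: sum.reindex[OF inj])
  also have "\<dots> = 1" by (rule sum_pmf_eq_1) (use supp in auto)
  finally have m_sum: "sum m UNIV = 1" .
  have "h = (\<Sum>R\<in>UNIV. m R *\<^sub>R ?ind R)"
    unfolding mean m_def[symmetric] by (rule sum.mono_neutral_left) (use m_supp in auto)
  moreover have "0 \<le> m R" for R by (simp add: m_def)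
  ultimately obtain \<kappa> where \<kappa>: "coupling_from m \<kappa>" "coupling_mean \<kappa> = h'"
    "coupling_cost \<kappa> \<le> real (family_depth E \<A> + 1) * l1_norm (h - h')"
    using transport_coupling[of m h h'] m_sum m_supp h' by blast
  have nonneg: "0 \<le> \<kappa> $ p" and \<kappa>_supp: "B \<notin> bases M \<Longrightarrow> \<kappa> $ (R, B) = 0"
    and row: "(\<Sum>B\<in>UNIV. \<kappa> $ (R, B)) = m R" for p R B
    using \<kappa>(1) unfolding coupling_from_def by blast+
  have split: "(\<Sum>p\<in>UNIV. f p) = (\<Sum>R\<in>UNIV. \<Sum>B\<in>UNIV. f (R, B))"
    for f :: "'e set \<times> 'e set \<Rightarrow> 'z::comm_monoid_add"
    unfolding UNIV_Times_UNIV[symmetric] sum.cartesian_product by (intro sum.cong) auto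
  have "sum (($) \<kappa>) UNIV = 1" unfolding split row by (rule m_sum)
  then obtain p where p: "\<And>x. pmf p x = \<kappa> $ x"
    using ex_pmf_finite_support[of UNIV "($) \<kappa>"] nonneg by auto
  note marg = coupling_marginals[of UNIV p, OF finite_class.finite, simplified]
  \<comment> \<open>The image of the coupling under \<open>indicator_vec\<close> in both components.
    By injectivity no two pairs of sets are merged, so each probability is a single entry of
    \<kappa>.\<close>
  define K where "K = map_pmf (map_prod ?ind ?ind) p"
  have K_fst: "map_pmf fst K = map_pmf ?ind (map_pmf fst p)"
    and K_snd: "map_pmf snd K = map_pmf ?ind (map_pmf snd p)"
    unfolding K_def by (simp_all add: pmf.map_comp o_def)
  have "map_pmf fst K = \<mu>"
  proof (rule pmf_eqI)
    fix v
    show "pmf (map_pmf fst K) v = pmf \<mu> v"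
    proof (cases "v \<in> range ?ind")
      case True
      then obtain R where "v = ?ind R" by blast
      then show ?thesis
        using marg(1)[of R] row[of R]
        by (simp add: K_fst pmf_map_inj'[OF inj_indicator_vec] p m_def)
    next
      case False
      then have "v \<notin> set_pmf \<mu>" "v \<notin> set_pmf (map_pmf fst K)"
        using supp unfolding K_fst by auto
      then show ?thesis unfolding set_pmf_iff by simp
    qed
  qed
  moreover have "represents ?P h' (map_pmf snd K)"
    unfolding represents_def V
  proof
    show "set_pmf (map_pmf snd K) \<subseteq> ?ind ` bases M"
    proof
      fix v assume "v \<in> set_pmf (map_pmf snd K)"
      then obtain R B where "(R, B) \<in> set_pmf p" "v = ?ind B" unfolding K_snd by auto
      then show "v \<in> ?ind ` bases M" using \<kappa>_supp[of B R] by (auto simp: set_pmf_iff p)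
    qed
    have "(\<Sum>v\<in>?ind ` bases M. pmf (map_pmf snd K) v *\<^sub>R v) =
        (\<Sum>B\<in>bases M. (\<Sum>R\<in>UNIV. \<kappa> $ (R, B)) *\<^sub>R ?ind B)"
      unfolding K_snd sum.reindex[OF inj] o_def pmf_map_inj'[OF inj_indicator_vec] marg(2)[symmetric] p ..
    also have "\<dots> = (\<Sum>B\<in>UNIV. (\<Sum>R\<in>UNIV. \<kappa> $ (R, B)) *\<^sub>R ?ind B)"
      by (rule sum.mono_neutral_left) (use \<kappa>_supp in auto)
    also have "\<dots> = h'"
      unfolding \<kappa>(2)[symmetric] coupling_mean_def split scaleR_left.sum by (subst sum.swap) simp
    finally show "(\<Sum>v\<in>?ind ` bases M. pmf (map_pmf snd K) v *\<^sub>R v) = h'" .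
  qed
  moreover have "(\<Sum>v\<in>vertices ?P. \<Sum>v'\<in>vertices ?P. pmf K (v, v') * l1_norm (v - v')) \<le> coupling_cost \<kappa>"
  proof -
    have "pmf K (?ind R, ?ind B) = \<kappa> $ (R, B)" for R B
      using pmf_map_inj'[OF prod.inj_map[OF inj_indicator_vec inj_indicator_vec], of p "(R, B)"]
      by (simp add: K_def p)
    then have "(\<Sum>v\<in>vertices ?P. \<Sum>v'\<in>vertices ?P. pmf K (v, v') * l1_norm (v - v')) =
        (\<Sum>R\<in>bases M. \<Sum>B\<in>bases M. \<kappa> $ (R, B) * l1_norm (?ind R - ?ind B))"
      unfolding V by (simp add: sum.reindex[OF inj])
    also have "\<dots> = (\<Sum>x\<in>bases M \<times> bases M. \<kappa> $ x * l1_norm (?ind (fst x) - ?ind (snd x)))"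
      unfolding sum.cartesian_product by (intro sum.cong) auto
    \<comment> \<open>\<open>coupling_cost\<close> sums over all pairs of sets; the additional terms
      are nonnegative.\<close>
    also have "\<dots> \<le> coupling_cost \<kappa>"
      unfolding coupling_cost_def
      by (rule sum_mono2) (auto intro!: mult_nonneg_nonneg nonneg l1_norm_nonneg)
    finally show ?thesis .
  qed
  moreover have "OAT_vertex ?P h h' \<mu> \<le>
      (\<Sum>v\<in>vertices ?P. \<Sum>v'\<in>vertices ?P. pmf K (v, v') * l1_norm (v - v'))"
    unfolding OAT_vertex_def
  proof (rule cInf_lower)
    show "bdd_below {\<Sum>v\<in>vertices ?P. \<Sum>v'\<in>vertices ?P. pmf \<kappa> (v, v') * l1_norm (v - v') |\<mu>' \<kappa>.
        represents ?P h' \<mu>' \<and> map_pmf fst \<kappa> = \<mu> \<and> map_pmf snd \<kappa> = \<mu>'}"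
      by (rule bdd_belowI[of _ 0]) (auto intro!: sum_nonneg mult_nonneg_nonneg l1_norm_nonneg)
  qed (use calculation(1,2) in blast)
  ultimately show ?thesis using \<kappa>(3) by linarith
qed

lemma Lip_vertex_le: "Lip_vertex (basis_polytope M) \<le> of_nat (family_depth E \<A> + 1)"
  unfolding Lip_vertex_def
proof (rule Sup_least)
  fix r
  assume "r \<in> {ennreal (OAT_vertex (basis_polytope M) h h' \<mu> / l1_norm (h - h')) |h h' \<mu>.
    h \<in> basis_polytope M \<and> h' \<in> basis_polytope M \<and> h \<noteq> h' \<and> represents (basis_polytope M) h \<mu>}"
  then obtain h h' \<mu> where r: "r = ennreal (OAT_vertex (basis_polytope M) h h' \<mu> / l1_norm (h - h'))"
    and h: "h' \<in> basis_polytope M" "h \<noteq> h'" "represents (basis_polytope M) h \<mu>" by blast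
  have "0 < l1_norm (h - h')"
    using h(2) l1_norm_nonneg[of "h - h'"] l1_norm_eq_0_iff[of "h - h'"] by simp
  then have "OAT_vertex (basis_polytope M) h h' \<mu> / l1_norm (h - h') \<le> real (family_depth E \<A> + 1)"
    using OAT_vertex_le[OF h(3,1)] by (simp add: pos_divide_le_eq)
  then have "r \<le> ennreal (real (family_depth E \<A> + 1))" unfolding r by (rule ennreal_leI)
  then show "r \<le> of_nat (family_depth E \<A> + 1)" by (simp only: ennreal_of_nat_eq_real_of_nat)
qed

end

theorem theorem5p13:
  fixes E :: "'e::finite set" and \<A> :: "'e set set" and u :: "'e set \<Rightarrow> nat" and l :: nat
    and M :: "'e set set"
  assumes "laminar_family E \<A>" and "E \<in> \<A>" and "l = family_depth E \<A>" and "l \<ge> 1"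
    and "M = laminar_matroid E \<A> u"
  shows "Lip (basis_polytope M) \<le> Lip_vertex (basis_polytope M)
    \<and> Lip_vertex (basis_polytope M) \<le> of_nat (l + 1)"
proof
  interpret laminar_capacities E \<A> u by unfold_locales (fact assms(1,2))+
  have "polytope (basis_polytope M)"
    unfolding basis_polytope_def by (intro polytope_convex_hull finite_imageI finite_class.finite)
  then show "Lip (basis_polytope M) \<le> Lip_vertex (basis_polytope M)" by (rule Lip_le_Lip_vertex)
  show "Lip_vertex (basis_polytope M) \<le> of_nat (l + 1)"
    unfolding assms(3,5) by (rule Lip_vertex_le)
qed

end
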